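(* Fix $d\geq1$ and $1\leq p < \infty$. Consider the functional defined on the unit sphere $\{c\in\mathbb{C}^d: |c_1|^2+\cdots+|c_d|^2=1\}$ of $\mathbb{C}^d$ by $$\mathscr{K}_p(c) := \|c_1 z_1 + \cdots + c_d z_d\|_{H^p(\mathbb{T}^d)}.$$ Then $c=(c_1,\ldots,c_d)$ in the unit sphere is a critical point of $\mathscr{K}_p$ if and only if $\varphi(z) = c_1 z_1 + \cdots + c_d z_d$ is a Hilbert point in $H^p(\mathbb{T}^d)$.
   Context: $\mathbb{T}^d$ is the $d$-dimensional torus with normalized Haar measure $m_d$; $\widehat f(\alpha)=\int_{\mathbb{T}^d} f(z)\overline{z^\alpha}\,dm_d(z)$ for $\alpha\in\mathbb{Z}^d$. The Hardy space $H^p(\mathbb{T}^d)$ is the closed subspace of $L^p(\mathbb{T}^d)$ of functions $f$ with $\widehat f(\alpha)=0$ for all $\alpha\in\mathbb{Z}^d\setminus\mathbb{N}_0^d$, $\mathbb{N}_0=\{0,1,2,\ldots\}$, with the $L^p$ norm $\|\cdot\|_{H^p(\mathbb{T}^d)}$. Write $\langle f,g\rangle=\int_{\mathbb{T}^d} f\overline g\,dm_d$. A nontrivial (i.e. not a.e. zero) function $\varphi$ in $H^p(\mathbb{T}^d)$ is a Hilbert point in $H^p(\mathbb{T}^d)$ if $\|\varphi\|_{H^p(\mathbb{T}^d)}\le\|\varphi+f\|_{H^p(\mathbb{T}^d)}$ for every $f\in H^p(\mathbb{T}^d)$ such that $\langle f,\varphi\rangle=0$. When $1\le p<2$, the condition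 $\langle f,\varphi\rangle=0$ is declared to mean that $f$ lies in the closure in $H^p(\mathbb{T}^d)$ of the set of analytic polynomials $g$ with $\langle g,\varphi\rangle=0$. The unit sphere of $\mathbb{C}^d$ is regarded as a real submanifold of $\mathbb{C}^d\cong\mathbb{R}^{2d}$, and a critical point is a point where the differential of $\mathscr{K}_p$ along the sphere vanishes. *)

theory Defs
  imports "HOL-Analysis.Analysis"
begin

text \<open>The dimension \<open>d \<ge> 1\<close> is \<open>CARD('d)\<close> for a (nonempty) finite index type \<open>'d\<close>.
  Points of the torus are functions \<open>z :: 'd \<Rightarrow> complex\<close> with all \<open>z i\<close> on the unit circle;
  coefficient vectors live in the Euclidean space \<open>complex ^ 'd\<close>.\<close>

text \<open>Normalized Haar measure on the circle: the image of normalized Lebesgue measure on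
  \<open>[0, 2\<pi>]\<close> under \<open>t \<mapsto> exp (i t)\<close>.\<close>

definition circle_measure :: "complex measure" where
  "circle_measure =
     distr (uniform_measure lborel {0..2 * pi}) (restrict_space borel (sphere 0 1)) cis"

definition torus :: "('d::finite \<Rightarrow> complex) measure" where
  "torus = PiM UNIV (\<lambda>_. circle_measure)"

definition fourier_coeff :: "(('d::finite \<Rightarrow> complex) \<Rightarrow> complex) \<Rightarrow> ('d \<Rightarrow> int) \<Rightarrow> complex" where
  "fourier_coeff f \<alpha> = (LINT z|torus. f z * cnj (\<Prod>i\<in>UNIV. z i powi \<alpha> i))"

definition inner_torus ::
    "(('d::finite \<Rightarrow> complex) \<Rightarrow> complex) \<Rightarrow> (('d \<Rightarrow> complex) \<Rightarrow> complex) \<Rightarrow> complex" where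
  "inner_torus f g = (LINT z|torus. f z * cnj (g z))"

definition Hp_norm :: "real \<Rightarrow> (('d::finite \<Rightarrow> complex) \<Rightarrow> complex) \<Rightarrow> real" where
  "Hp_norm p f = (LINT z|torus. norm (f z) powr p) powr (1 / p)"

text \<open>Elements of \<open>L\<^sup>p\<close> and \<open>H\<^sup>p\<close> are represented by measurable functions rather than by
  classes modulo equality almost everywhere; norms, pairings and Fourier coefficients depend only
  on the class.\<close>

definition Hardy :: "real \<Rightarrow> (('d::finite \<Rightarrow> complex) \<Rightarrow> complex) set" where
  "Hardy p = {f. f \<in> borel_measurable torus \<and>
                 integrable torus (\<lambda>z. norm (f z) powr p) \<and>
                 (\<forall>\<alpha>. (\<exists>i. \<alpha> i < 0) \<longrightarrow> fourier_coeff f \<alpha> = 0)}"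

definition analytic_polynomials :: "(('d::finite \<Rightarrow> complex) \<Rightarrow> complex) set" where
  "analytic_polynomials =
     {\<lambda>z. \<Sum>\<alpha>\<in>A. a \<alpha> * (\<Prod>i\<in>UNIV. z i ^ \<alpha> i) |
        (A :: ('d \<Rightarrow> nat) set) (a :: ('d \<Rightarrow> nat) \<Rightarrow> complex). finite A}"

definition Hp_closure ::
    "real \<Rightarrow> (('d::finite \<Rightarrow> complex) \<Rightarrow> complex) set \<Rightarrow> (('d \<Rightarrow> complex) \<Rightarrow> complex) set" where
  "Hp_closure p S = {f \<in> Hardy p. \<forall>\<epsilon>>0. \<exists>g\<in>S. Hp_norm p (\<lambda>z. f z - g z) < \<epsilon>}"

text \<open>For \<open>p < 2\<close> the product of \<open>f\<close> and \<open>cnj \<phi>\<close> need not be integrable, and the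
  orthogonality relation is declared through the closure of the orthogonal polynomials.\<close>

definition Hp_orthogonal ::
    "real \<Rightarrow> (('d::finite \<Rightarrow> complex) \<Rightarrow> complex) \<Rightarrow> (('d \<Rightarrow> complex) \<Rightarrow> complex) \<Rightarrow> bool" where
  "Hp_orthogonal p f \<phi> \<longleftrightarrow>
     (if p < 2 then f \<in> Hp_closure p {g \<in> analytic_polynomials. inner_torus g \<phi> = 0}
      else inner_torus f \<phi> = 0)"

definition Hilbert_point :: "real \<Rightarrow> (('d::finite \<Rightarrow> complex) \<Rightarrow> complex) \<Rightarrow> bool" where
  "Hilbert_point p \<phi> \<longleftrightarrow>
     \<phi> \<in> Hardy p \<and> \<not> (AE z in torus. \<phi> z = 0) \<and>
     (\<forall>f\<in>Hardy p. Hp_orthogonal p f \<phi> \<longrightarrow> Hp_norm p \<phi> \<le> Hp_norm p (\<lambda>z. \<phi> z + f z))"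

definition linear_form :: "complex ^ 'd \<Rightarrow> ('d::finite \<Rightarrow> complex) \<Rightarrow> complex" where
  "linear_form c z = (\<Sum>i\<in>UNIV. c $ i * z i)"

definition K_functional :: "real \<Rightarrow> complex ^ 'd::finite \<Rightarrow> real" where
  "K_functional p c = Hp_norm p (linear_form c)"

text \<open>The differential along the sphere is the derivative within the sphere, which depends
  only on the values of \<open>F\<close> on the sphere and is determined on the tangent space \<open>v \<bullet> c = 0\<close>.
  Here \<open>\<bullet>\<close> is the real inner product of \<open>complex ^ 'd\<close> as a real space of dimension \<open>2d\<close>.
  Differentiability of \<open>F\<close> at \<open>c\<close> along the sphere is part of being critical.\<close>

definition critical_point_on_sphere :: "('a::euclidean_space \<Rightarrow> real) \<Rightarrow> 'a \<Rightarrow> bool" where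
  "critical_point_on_sphere F c \<longleftrightarrow>
     c \<in> sphere 0 1 \<and>
     (\<exists>D. (F has_derivative D) (at c within sphere 0 1) \<and> (\<forall>v. v \<bullet> c = 0 \<longrightarrow> D v = 0))"

end

theory Submission
  imports Defs "HOL-Probability.Infinite_Product_Measure"
begin

text \<open>
  Write \<open>\<phi>\<close> for the linear form with coefficients \<open>c\<close> and \<open>g = \<bar>\<phi>\<bar>\<^sup>p\<^sup>-\<^sup>2 \<phi>\<close>. Since
  \<open>\<phi> \<noteq> 0\<close> almost everywhere, \<open>\<parallel>\<phi>\<parallel>\<^sup>p\<close> is differentiable in \<open>c\<close>, with derivative \<open>p Re \<langle>\<phi>\<^sub>w, g\<rangle>\<close>
  in the direction \<open>w\<close> (where \<open>\<phi>\<^sub>w\<close> is the linear form of \<open>w\<close>). Multiplying \<open>c\<close> by a phase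
  does not change the norm, so \<open>c\<close> is critical iff \<open>\<langle>\<phi>\<^sub>w, g\<rangle> = 0\<close> for all \<open>w\<close> that are
  orthogonal to \<open>c\<close> in the complex sense. A Hilbert point minimizes the norm in these directions,
  which gives one implication.

  Conversely, \<open>g = \<phi> h(\<bar>\<phi>\<bar>\<^sup>2)\<close> is a limit of trigonometric polynomials \<open>\<phi> P(\<bar>\<phi>\<bar>\<^sup>2)\<close> of total
  degree one, and the only frequencies of total degree one available to \<open>f \<in> H\<^sup>p\<close> are the unit
  multi-indices. Hence \<open>\<langle>f, g\<rangle> = \<langle>\<phi>\<^sub>w, g\<rangle>\<close>, where \<open>w\<close> collects these coefficients of \<open>f\<close>, and \<open>w\<close>
  is orthogonal to \<open>c\<close> whenever \<open>f\<close> is orthogonal to \<open>\<phi>\<close>. Integrating the convexity inequality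
  \<open>\<bar>a + b\<bar>\<^sup>p \<ge> \<bar>a\<bar>\<^sup>p + p \<bar>a\<bar>\<^sup>p\<^sup>-\<^sup>2 Re (b cnj a)\<close> then yields \<open>\<parallel>\<phi>\<parallel> \<le> \<parallel>\<phi> + f\<parallel>\<close>.
\<close>

subsection \<open>Haar measure on the circle\<close>

lemma space_circle_measure [simp]: "space circle_measure = sphere 0 1"
  by (simp add: circle_measure_def space_restrict_space)

lemma measurable_cis_sphere:
  "cis \<in> measurable (uniform_measure lborel {0..2 * pi}) (restrict_space borel (sphere 0 1))"
proof -
  have "cis \<in> borel_measurable borel"
    by (intro borel_measurable_continuous_onI) (auto intro: continuous_intros)
  then show ?thesis
    by (intro measurable_restrict_space2) auto
qed

lemma prob_space_circle_measure: "prob_space circle_measure"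
  unfolding circle_measure_def
proof (rule prob_space.prob_space_distr)
  show "prob_space (uniform_measure lborel {0..2 * pi})"
    by (rule prob_space_uniform_measure) auto
qed (rule measurable_cis_sphere)

lemma measurable_circle_measure_borel:
  assumes "f \<in> borel_measurable borel"
  shows "f \<in> borel_measurable circle_measure"
  unfolding circle_measure_def measurable_distr_eq1
  using assms by (rule measurable_restrict_space1)

text \<open>The fibre of \<open>cis\<close> over \<open>a\<close> is empty or lies in a translate of
  2 pi Z, hence is countable and Lebesgue null. This is the one-variable input for the zero set of a
  linear form.\<close>

lemma AE_circle_measure_neq: "AE z in circle_measure. z \<noteq> a"
proof -
  have "countable {t. cis t = a}"
  proof (cases "\<exists>s. cis s = a")
    case True
    then obtain s where s: "cis s = a" by blast
    have "{t. cis t = a} \<subseteq> range (\<lambda>n::int. s + 2 * pi * n)"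
    proof
      fix t assume "t \<in> {t. cis t = a}"
      then have "sin t = sin s \<and> cos t = cos s"
        using s by (auto simp: complex_eq_iff)
      then show "t \<in> range (\<lambda>n::int. s + 2 * pi * n)"
        unfolding sin_cos_eq_iff by blast
    qed
    then show ?thesis
      by (rule countable_subset) auto
  next
    case False
    then have "{t. cis t = a} = {}" by auto
    then show ?thesis by simp
  qed
  then have "{t. cis t = a} \<in> null_sets lborel"
    by (rule countable_imp_null_set_lborel)
  then have *: "AE t in lborel. cis t \<noteq> a"
    by (rule AE_I') auto
  have "AE t in uniform_measure lborel {0..2 * pi}. cis t \<noteq> a"
    by (rule AE_uniform_measureI) (use * in auto)
  moreover have "{z \<in> space (restrict_space borel (sphere 0 1)). z \<noteq> a}
      \<in> sets (restrict_space borel (sphere 0 1 :: complex set))"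
  proof -
    have "{z \<in> space (restrict_space borel (sphere 0 1)). z \<noteq> a} = sphere 0 1 \<inter> (- {a})"
      by (auto simp: space_restrict_space)
    moreover have "- {a} \<in> sets borel" by simp
    ultimately show ?thesis
      unfolding sets_restrict_space by (metis image_eqI)
  qed
  ultimately show ?thesis
    unfolding circle_measure_def
    by (simp only: AE_distr_iff[OF measurable_cis_sphere])
qed

text \<open>For \<open>n \<noteq> 0\<close> the integrand has a 2 pi periodic antiderivative in the
  angle, so the boundary values cancel.\<close>

lemma integral_circle_measure_powi:
  "(LINT z|circle_measure. z powi n) = (if n = 0 then 1 else 0)"
proof (cases "n = 0")
  case True
  then show ?thesis
    using prob_space.prob_space[OF prob_space_circle_measure] by simp
next
  case False
  have powi_meas: "(\<lambda>z::complex. z powi n) \<in> borel_measurable borel"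
    unfolding power_int_def by measurable
  \<comment> \<open>Written as a density, the uniform measure turns the integral into a Lebesgue
    integral over an interval, to which the fundamental theorem of calculus applies.\<close>
  have unif: "uniform_measure lborel {0..2 * pi} =
      density lborel (\<lambda>x. ennreal (indicator {0..2 * pi} x / (2 * pi)))"
  proof -
    have "indicator {0..2 * pi} x / emeasure lborel {0..2 * pi}
        = ennreal (indicator {0..2 * pi} x / (2 * pi))" for x :: real
      by (simp add: indicator_def divide_ennreal flip: ennreal_1)
    then show ?thesis
      unfolding uniform_measure_def by simp
  qed
  have "(LINT z|circle_measure. z powi n) = (LINT t|uniform_measure lborel {0..2 * pi}. cis t powi n)"
    unfolding circle_measure_def
    by (intro integral_distr measurable_cis_sphere measurable_restrict_space1 powi_meas)
  also have "\<dots> = (LINT t|lborel. (indicator {0..2 * pi} t / (2 * pi)) *\<^sub>R cis t powi n)"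
    unfolding unif
  proof (rule integral_density)
    show "(\<lambda>t. cis t powi n) \<in> borel_measurable lborel"
      unfolding cis_power_int measurable_lborel2
      by (intro borel_measurable_continuous_onI) (auto intro!: continuous_intros)
  qed auto
  also have "\<dots> = (LINT t|lborel. (1 / (2 * pi)) *\<^sub>R (indicator {0..2 * pi} t *\<^sub>R cis (of_int n * t)))"
    by (rule Bochner_Integration.integral_cong) (auto simp: cis_power_int mult.commute)
  also have "\<dots> = (1 / (2 * pi)) *\<^sub>R (LINT t|lborel. indicator {0..2 * pi} t *\<^sub>R cis (of_int n * t))"
    by (rule integral_scaleR_right)
  also have "(LINT t|lborel. indicator {0..2 * pi} t *\<^sub>R cis (of_int n * t))
      = cis (of_int n * (2 * pi)) / (\<i> * of_int n) - cis (of_int n * 0) / (\<i> * of_int n)"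
  proof (rule integral_FTC_atLeastAtMost)
    fix t :: real
    show "((\<lambda>t. cis (of_int n * t) / (\<i> * of_int n)) has_vector_derivative cis (of_int n * t))
        (at t within {0..2 * pi})"
    proof -
      \<comment> \<open>The antiderivative is differentiated as a holomorphic function and then
        restricted to the real line; \<open>n \<noteq> 0\<close> permits the division.\<close>
      have "((\<lambda>w. exp (\<i> * of_int n * w) / (\<i> * of_int n)) has_field_derivative
          exp (\<i> * of_int n * of_real t)) (at (of_real t))"
        using False by (auto intro!: derivative_eq_intros)
      from has_vector_derivative_real_field[OF this] show ?thesis
        by (simp add: cis_conv_exp mult.assoc)
    qed
  qed (auto intro!: continuous_intros)
  also have "cis (of_int n * (2 * pi)) = 1"
    by (metis cis_multiple_2pi Ints_of_int mult.commute mult.left_commute)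
  finally show ?thesis
    using False by simp
qed

subsection \<open>Characters and linear forms on the torus\<close>

lemma borel_measurable_cnj: "f \<in> borel_measurable M \<Longrightarrow> (\<lambda>x. cnj (f x)) \<in> borel_measurable M"
  by (rule borel_measurable_continuous_on[OF continuous_on_cnj[OF continuous_on_id]])

lemma prob_space_torus: "prob_space torus"
  unfolding torus_def by (intro prob_space_PiM prob_space_circle_measure)

lemma norm_torus: "z \<in> space torus \<Longrightarrow> norm (z i) = 1"
  by (auto simp: torus_def space_PiM PiE_def Pi_def)

lemma cnj_torus: "z \<in> space torus \<Longrightarrow> cnj (z i) = inverse (z i)"
  using norm_torus[of z i] by (simp add: inverse_eq_divide divide_conv_cnj)

lemma nonzero_torus: "z \<in> space torus \<Longrightarrow> z i \<noteq> 0"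
  using norm_torus[of z i] by auto

lemma measurable_torus_component [measurable]: "(\<lambda>z. z i) \<in> borel_measurable torus"
proof -
  have "(\<lambda>z. z i) \<in> measurable torus circle_measure"
    unfolding torus_def by (rule measurable_component_singleton) auto
  moreover have "(\<lambda>x. x) \<in> borel_measurable circle_measure"
    by (intro measurable_circle_measure_borel) auto
  ultimately show ?thesis
    by (rule measurable_compose)
qed

lemma integrable_torus_bounded:
  fixes f :: "('d::finite \<Rightarrow> complex) \<Rightarrow> 'b::{banach, second_countable_topology}"
  assumes [measurable]: "f \<in> borel_measurable torus"
    and "\<And>z. z \<in> space torus \<Longrightarrow> norm (f z) \<le> B"
  shows "integrable torus f"
proof -
  interpret prob_space "torus :: ('d \<Rightarrow> complex) measure" by (rule prob_space_torus)
  show ?thesis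
    by (rule integrable_const_bound[where B = B]) (use assms in auto)
qed

lemma integrable_torus_mult_bounded:
  fixes f g :: "('d::finite \<Rightarrow> complex) \<Rightarrow> complex"
  assumes f: "integrable torus f" and g [measurable]: "g \<in> borel_measurable torus"
    and bound: "\<And>z. z \<in> space torus \<Longrightarrow> norm (g z) \<le> B"
  shows "integrable torus (\<lambda>z. f z * g z)"
proof (rule Bochner_Integration.integrable_bound)
  show "integrable torus (\<lambda>z. B * norm (f z))"
    using f by auto
  show "(\<lambda>z. f z * g z) \<in> borel_measurable torus"
    using f by measurable
  have "norm (f z * g z) \<le> norm (B * norm (f z))" if "z \<in> space torus" for z
  proof -
    have "norm (f z) * norm (g z) \<le> norm (f z) * B"
      using bound[OF that] by (rule mult_left_mono) simp
    also have "\<dots> \<le> norm (B * norm (f z))" by (simp add: mult.commute)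
    finally show ?thesis by (simp add: norm_mult)
  qed
  then show "AE z in torus. norm (f z * g z) \<le> norm (B * norm (f z))"
    by auto
qed

section \<open>Characters and Fourier coefficients\<close>

definition torus_char :: "('d::finite \<Rightarrow> int) \<Rightarrow> ('d \<Rightarrow> complex) \<Rightarrow> complex" where
  "torus_char \<alpha> z = (\<Prod>i\<in>UNIV. z i powi \<alpha> i)"

text \<open>Integer valued, so that it can be compared with arbitrary frequencies; its character is
  the \<open>i\<close>-th coordinate.\<close>

definition unit_index :: "'d \<Rightarrow> 'd \<Rightarrow> int" where
  "unit_index i j = (if j = i then 1 else 0)"

lemma unit_index_eq_iff: "unit_index i = unit_index j \<longleftrightarrow> i = j"
  by (auto simp: unit_index_def fun_eq_iff)

lemma sum_unit_index: "(\<Sum>j\<in>UNIV. unit_index i j) = 1" for i :: "'d::finite"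
  by (simp add: unit_index_def)

lemma measurable_torus_char [measurable]: "torus_char \<alpha> \<in> borel_measurable torus"
  unfolding torus_char_def power_int_def by measurable

lemma measurable_cnj_torus_char [measurable]:
  "(\<lambda>z. cnj (torus_char \<alpha> z)) \<in> borel_measurable torus"
  by (intro borel_measurable_cnj measurable_torus_char)

lemma norm_torus_char: "z \<in> space torus \<Longrightarrow> norm (torus_char \<alpha> z) = 1"
  by (simp add: torus_char_def norm_power_int norm_torus flip: prod_norm)

lemma cnj_torus_char:
  "z \<in> space torus \<Longrightarrow> cnj (torus_char \<alpha> z) = torus_char (\<lambda>i. - \<alpha> i) z"
  by (simp add: torus_char_def cnj_torus power_int_minus power_int_inverse)

lemma torus_char_add:
  "z \<in> space torus \<Longrightarrow> torus_char (\<lambda>i. \<alpha> i + \<beta> i) z = torus_char \<alpha> z * torus_char \<beta> z"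
  by (simp add: torus_char_def power_int_add nonzero_torus prod.distrib)

lemma torus_char_unit_index: "torus_char (unit_index i) = (\<lambda>z. z i)"
proof
  fix z :: "'a \<Rightarrow> complex"
  have "torus_char (unit_index i) z = (\<Prod>j\<in>UNIV. if j = i then z i else 1)"
    unfolding torus_char_def unit_index_def by (intro prod.cong) auto
  then show "torus_char (unit_index i) z = z i" by simp
qed

lemma fourier_coeff_char: "fourier_coeff f \<alpha> = (LINT z|torus. f z * cnj (torus_char \<alpha> z))"
  by (simp add: fourier_coeff_def torus_char_def)

text \<open>A character is a product of functions of one coordinate each, so Fubini reduces the
  integral to the circle.\<close>

lemma integral_torus_char:
  "(LINT z|torus. torus_char \<alpha> z) = (if \<alpha> = (\<lambda>_. 0) then 1 else 0)" for \<alpha> :: "'d::finite \<Rightarrow> int"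
proof -
  interpret C: prob_space circle_measure by (rule prob_space_circle_measure)
  interpret product_sigma_finite "\<lambda>_::'d. circle_measure" by standard
  have meas: "(\<lambda>z. z powi n) \<in> borel_measurable circle_measure" for n
    by (intro measurable_circle_measure_borel) (unfold power_int_def, measurable)
  have int: "integrable circle_measure (\<lambda>z. z powi n)" for n
    by (rule C.integrable_const_bound[where B = 1]) (auto simp: norm_power_int meas)
  have "(LINT z|torus. torus_char \<alpha> z) = (\<Prod>i\<in>UNIV. LINT z|circle_measure. z powi \<alpha> i)"
    unfolding torus_def torus_char_def by (rule product_integral_prod) (use int in auto)
  also have "\<dots> = (if \<alpha> = (\<lambda>_. 0) then 1 else 0)"
    by (auto simp: integral_circle_measure_powi fun_eq_iff)
  finally show ?thesis .
qed

lemma fourier_coeff_char_eq: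
  "fourier_coeff (torus_char \<alpha>) \<beta> = (if \<alpha> = \<beta> then 1 else 0)"
proof -
  have "fourier_coeff (torus_char \<alpha>) \<beta> = (LINT z|torus. torus_char (\<lambda>i. \<alpha> i + - \<beta> i) z)"
    unfolding fourier_coeff_char
    by (intro Bochner_Integration.integral_cong refl)
      (simp only: cnj_torus_char torus_char_add[of _ \<alpha> "\<lambda>i. - \<beta> i"])
  moreover have "(\<lambda>i. \<alpha> i + - \<beta> i) = (\<lambda>_. 0) \<longleftrightarrow> \<alpha> = \<beta>"
    unfolding fun_eq_iff by simp
  ultimately show ?thesis
    by (simp add: integral_torus_char)
qed

lemma integrable_fourier:
  assumes "integrable torus f"
  shows "integrable torus (\<lambda>z. f z * cnj (torus_char \<alpha> z))"
  by (rule integrable_torus_mult_bounded[OF assms, where B = 1]) (auto simp: norm_torus_char)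

lemma fourier_coeff_sum:
  assumes "\<And>i. i \<in> I \<Longrightarrow> integrable torus (f i)"
  shows "fourier_coeff (\<lambda>z. \<Sum>i\<in>I. a i * f i z) \<alpha> = (\<Sum>i\<in>I. a i * fourier_coeff (f i) \<alpha>)"
proof -
  have "fourier_coeff (\<lambda>z. \<Sum>i\<in>I. a i * f i z) \<alpha>
      = (LINT z|torus. (\<Sum>i\<in>I. a i * (f i z * cnj (torus_char \<alpha> z))))"
    by (simp add: fourier_coeff_char sum_distrib_right mult.assoc)
  also have "\<dots> = (\<Sum>i\<in>I. LINT z|torus. a i * (f i z * cnj (torus_char \<alpha> z)))"
    by (intro Bochner_Integration.integral_sum integrable_mult_right integrable_fourier assms)
  finally show ?thesis
    by (simp add: fourier_coeff_char)
qed

section \<open>Linear forms: bounds, coefficients and zeros\<close>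

lemma measurable_linear_form [measurable]: "linear_form c \<in> borel_measurable torus"
  unfolding linear_form_def by measurable

text \<open>This is the maximum of the modulus of the form over the torus, attained by aligning the
  phases. It supplies the uniform bounds for integrability and dominated convergence.\<close>

definition form_bound :: "complex ^ 'd::finite \<Rightarrow> real" where
  "form_bound c = (\<Sum>i\<in>UNIV. norm (c $ i))"

lemma form_bound_nonneg: "0 \<le> form_bound c"
  by (simp add: form_bound_def sum_nonneg)

lemma norm_linear_form_le:
  assumes "z \<in> space torus"
  shows "norm (linear_form c z) \<le> form_bound c"
proof -
  have "norm (linear_form c z) \<le> (\<Sum>i\<in>UNIV. norm (c $ i * z i))"
    unfolding linear_form_def by (rule norm_sum)
  then show ?thesis
    by (simp add: form_bound_def norm_mult norm_torus[OF assms])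
qed

lemma form_bound_le: "form_bound c \<le> real CARD('d) * norm c" for c :: "complex ^ 'd::finite"
  unfolding form_bound_def
  by (rule sum_bounded_above) (rule Finite_Cartesian_Product.norm_nth_le)

lemma integrable_linear_form: "integrable torus (linear_form c)"
  by (rule integrable_torus_bounded[OF measurable_linear_form norm_linear_form_le])

lemma integrable_component: "integrable torus (\<lambda>z. z i)"
  by (rule integrable_torus_bounded[where B = 1]) (auto simp: norm_torus)

lemma fourier_coeff_linear_form:
  "fourier_coeff (linear_form c) \<alpha> = (\<Sum>i\<in>UNIV. if \<alpha> = unit_index i then c $ i else 0)"
proof -
  have "fourier_coeff (linear_form c) \<alpha> = (\<Sum>i\<in>UNIV. c $ i * fourier_coeff (\<lambda>z. z i) \<alpha>)"
    unfolding linear_form_def[abs_def] by (rule fourier_coeff_sum) (rule integrable_component)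
  also have "\<dots> = (\<Sum>i\<in>UNIV. c $ i * fourier_coeff (torus_char (unit_index i)) \<alpha>)"
    by (simp only: torus_char_unit_index)
  also have "\<dots> = (\<Sum>i\<in>UNIV. if \<alpha> = unit_index i then c $ i else 0)"
    by (intro sum.cong refl) (auto simp: fourier_coeff_char_eq)
  finally show ?thesis .
qed

lemma fourier_coeff_linear_form_unit:
  "fourier_coeff (linear_form c) (unit_index i) = c $ i"
  by (simp add: fourier_coeff_linear_form unit_index_eq_iff)

text \<open>The conjugated form is a finite combination of conjugated characters. Orthogonality to a
  linear form thereby becomes a condition on finitely many Fourier coefficients.\<close>

lemma inner_torus_linear_form:
  assumes "integrable torus f"
  shows "inner_torus f (linear_form c) = (\<Sum>i\<in>UNIV. fourier_coeff f (unit_index i) * cnj (c $ i))"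
proof -
  have "inner_torus f (linear_form c)
      = (LINT z|torus. (\<Sum>i\<in>UNIV. cnj (c $ i) * (f z * cnj (torus_char (unit_index i) z))))"
    by (simp add: inner_torus_def linear_form_def sum_distrib_left torus_char_unit_index mult_ac)
  also have "\<dots> = (\<Sum>i\<in>UNIV. LINT z|torus. cnj (c $ i) * (f z * cnj (torus_char (unit_index i) z)))"
    by (intro Bochner_Integration.integral_sum integrable_mult_right integrable_fourier assms)
  finally show ?thesis
    by (simp add: fourier_coeff_char mult.commute)
qed

text \<open>The Hermitian inner product. Unlike the real tangent space of the sphere, the complement
  of \<open>c\<close> with respect to it is stable under multiplication by
  \<open>\<i>\<close>.\<close>

definition cinner :: "complex ^ 'd::finite \<Rightarrow> complex ^ 'd \<Rightarrow> complex" where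
  "cinner v w = (\<Sum>i\<in>UNIV. v $ i * cnj (w $ i))"

lemma inner_torus_linear_forms: "inner_torus (linear_form w) (linear_form c) = cinner w c"
  by (simp add: inner_torus_linear_form[OF integrable_linear_form]
      fourier_coeff_linear_form_unit cinner_def)

text \<open>Some coefficient \<open>c $ i\<close> is nonzero. With the other coordinates frozen, the
  form vanishes for at most one value of the \<open>i\<close>-th coordinate, which is a null set on
  the circle; Tonelli then gives measure zero.\<close>

lemma linear_form_neq_zero_AE:
  fixes c :: "complex ^ 'd::finite"
  assumes "c \<noteq> 0"
  shows "AE z in torus. linear_form c z \<noteq> 0"
proof -
  from assms obtain i where i: "c $ i \<noteq> 0" by (auto simp: vec_eq_iff)
  interpret C: prob_space circle_measure by (rule prob_space_circle_measure)
  interpret product_sigma_finite "\<lambda>_::'d. circle_measure" by standard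
  let ?J = "UNIV - {i} :: 'd set"
  let ?N = "{z \<in> space torus. linear_form c z = 0}"
  have ins: "insert i ?J = UNIV" by auto
  have N: "?N \<in> sets torus" by measurable
  have "emeasure torus ?N = (\<integral>\<^sup>+ z. indicator ?N z \<partial>torus)"
    using N by simp
  also have "\<dots> = (\<integral>\<^sup>+ x. (\<integral>\<^sup>+ y. indicator ?N (x(i := y)) \<partial>circle_measure)
      \<partial>PiM ?J (\<lambda>_. circle_measure))"
  proof -
    have "indicator ?N \<in> borel_measurable (PiM (insert i ?J) (\<lambda>_. circle_measure))"
      unfolding ins using N by (auto simp: torus_def)
    from product_nn_integral_insert[OF _ _ this]
    show ?thesis unfolding ins torus_def by simp
  qed
  also have "\<dots> = (\<integral>\<^sup>+ x. 0 \<partial>PiM ?J (\<lambda>_. circle_measure))"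
  proof (rule nn_integral_cong)
    fix x :: "'d \<Rightarrow> complex"
    define r where "r = (\<Sum>j\<in>?J. c $ j * x j)"
    have "linear_form c (x(i := y)) = c $ i * y + r" for y
      unfolding linear_form_def r_def by (subst sum.remove[of UNIV i]) (auto intro: sum.cong)
    then have "linear_form c (x(i := y)) = 0 \<longleftrightarrow> y = - r / c $ i" for y
      using i by (metis add_eq_0_iff2 eq_divide_eq mult.commute)
    then have "AE y in circle_measure. indicator ?N (x(i := y)) = (0::ennreal)"
      using AE_circle_measure_neq[of "- r / c $ i"] by (auto simp: indicator_def)
    then show "(\<integral>\<^sup>+ y. indicator ?N (x(i := y)) \<partial>circle_measure) = 0"
      by (subst nn_integral_cong_AE[where v = "\<lambda>_. 0"]) auto
  qed
  finally have "emeasure torus ?N = 0" by simp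
  with N show ?thesis
    by (auto intro!: AE_I[where N = ?N])
qed

subsection \<open>The gradient of the moment functional\<close>

text \<open>Away from 0 this is the real gradient of \<open>|a|^p / p\<close>. Since
  \<open>0 powr x = 0\<close> for every \<open>x\<close>, the value at 0 is 0 even for
  \<open>p < 2\<close>, which keeps the tangent inequality valid there.\<close>

definition power_grad :: "real \<Rightarrow> complex \<Rightarrow> complex" where
  "power_grad p a = of_real (norm a powr (p - 2)) * a"

lemma norm_power_grad: "norm (power_grad p a) = norm a powr (p - 1)"
proof (cases "a = 0")
  case False
  then show ?thesis
    using powr_add[of "norm a" "p - 2" 1] by (simp add: power_grad_def norm_mult)
qed (simp add: power_grad_def)

lemma mult_cnj_power_grad: "a * cnj (power_grad p a) = of_real (norm a powr p)"
proof (cases "a = 0")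
  case False
  then have "norm a powr (p - 2) * (norm a)\<^sup>2 = norm a powr p"
    using powr_add[of "norm a" "p - 2" 2] by simp
  moreover have "a * cnj (power_grad p a) = of_real (norm a powr (p - 2)) * (a * cnj a)"
    by (simp add: power_grad_def)
  ultimately show ?thesis
    by (simp only: complex_norm_square[symmetric] of_real_mult[symmetric])
qed (simp add: power_grad_def)

lemma isCont_power_grad: "a \<noteq> 0 \<Longrightarrow> isCont (power_grad p) a"
  unfolding power_grad_def by (auto intro!: continuous_intros)

lemma measurable_power_grad [measurable]: "power_grad p \<in> borel_measurable borel"
  unfolding power_grad_def by measurable

section \<open>Convexity of the p-th power\<close>

lemma powr_above_tangent:
  fixes s t p :: real
  assumes p: "1 \<le> p" and s: "0 < s" and t: "0 \<le> t"
  shows "s powr p + p * s powr (p - 1) * (t - s) \<le> t powr p"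
proof (cases "t = 0")
  \<comment> \<open>Convexity is applied on the open half-line, which excludes this endpoint; here
    the claim reduces to \<open>(1 - p) * s powr p \<le> 0\<close>.\<close>
  case True
  have "s powr (p - 1) * s = s powr p"
    using s by (simp add: powr_diff)
  then have "s powr p + p * s powr (p - 1) * (t - s) = (1 - p) * s powr p"
    using True by (simp add: algebra_simps)
  also have "\<dots> \<le> 0"
    using p by (simp add: mult_nonpos_nonneg)
  finally show ?thesis
    using True by simp
next
  case False
  have "p * s powr (p - 1) * (t - s) \<le> t powr p - s powr p"
  proof (rule convex_on_imp_above_tangent[where A = "{0<..}" and f = "\<lambda>x. x powr p"])
    show "((\<lambda>x. x powr p) has_real_derivative p * s powr (p - 1)) (at s within {0<..})"
      using s by (auto intro!: derivative_eq_intros)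
  qed (use p s t False in \<open>auto intro: powr_convex simp: interior_open\<close>)
  then show ?thesis by simp
qed

text \<open>The bound \<open>Re ((a + b) * cnj a) \<le> |a + b| |a|\<close> reduces the claim to the
  tangent line inequality for real numbers with \<open>s = |a|\<close> and
  \<open>t = |a + b|\<close>. For \<open>a = 0\<close> the gradient term vanishes.\<close>

lemma norm_powr_above_tangent:
  assumes p: "1 \<le> p"
  shows "norm a powr p + p * Re (b * cnj (power_grad p a)) \<le> norm (a + b) powr p"
proof (cases "a = 0")
  case False
  let ?s = "norm a" and ?t = "norm (a + b)"
  have s: "0 < ?s" using False by simp
  have "Re ((a + b) * cnj a) \<le> ?t * ?s"
    using complex_Re_le_cmod[of "(a + b) * cnj a"] by (simp add: norm_mult)
  moreover have "Re ((a + b) * cnj a) = ?s\<^sup>2 + Re (b * cnj a)"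
    by (simp add: distrib_right complex_mult_cnj cmod_power2)
  ultimately have "Re (b * cnj a) \<le> ?s * (?t - ?s)"
    by (simp add: algebra_simps power2_eq_square)
  then have "?s powr (p - 2) * Re (b * cnj a) \<le> ?s powr (p - 2) * (?s * (?t - ?s))"
    by (rule mult_left_mono) simp
  moreover have "?s powr (p - 2) * ?s = ?s powr (p - 1)"
    using norm_power_grad[of p a] by (simp add: power_grad_def norm_mult)
  moreover have "Re (b * cnj (power_grad p a)) = ?s powr (p - 2) * Re (b * cnj a)"
    by (simp add: power_grad_def algebra_simps)
  ultimately have "Re (b * cnj (power_grad p a)) \<le> ?s powr (p - 1) * (?t - ?s)"
    by (metis mult.assoc)
  then have "p * Re (b * cnj (power_grad p a)) \<le> p * ?s powr (p - 1) * (?t - ?s)"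
    using p by (simp add: mult.assoc)
  then show ?thesis
    using powr_above_tangent[OF p s, of ?t] by simp
qed (use p in \<open>simp add: power_grad_def\<close>)

section \<open>The moment and its gradient pairing\<close>

lemma linear_form_add: "linear_form (c + h) z = linear_form c z + linear_form h z"
  by (simp add: linear_form_def distrib_right sum.distrib)

lemma linear_form_mult: "linear_form (\<chi> i. a * c $ i) z = a * linear_form c z"
  by (simp add: linear_form_def sum_distrib_left mult.assoc)

lemma linear_form_scaleR: "linear_form (r *\<^sub>R c) z = r *\<^sub>R linear_form c z"
  by (simp add: linear_form_def scaleR_sum_right)

text \<open>The p-th power of \<open>K_functional p c\<close>, differentiated first; the root is
  smooth at positive values.\<close>

definition moment :: "real \<Rightarrow> complex ^ 'd::finite \<Rightarrow> real" where
  "moment p c = (LINT z|torus. norm (linear_form c z) powr p)"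

text \<open>Only its real part enters the derivative of the moment. The complex value is kept
  because it is complex linear in \<open>w\<close>.\<close>

definition grad_pairing :: "real \<Rightarrow> complex ^ 'd::finite \<Rightarrow> complex ^ 'd \<Rightarrow> complex" where
  "grad_pairing p c w = inner_torus (linear_form w) (\<lambda>z. power_grad p (linear_form c z))"

lemma norm_power_grad_form_le:
  assumes "1 \<le> p" "z \<in> space torus"
  shows "norm (power_grad p (linear_form c z)) \<le> form_bound c powr (p - 1)"
  unfolding norm_power_grad
  using assms by (intro powr_mono2 norm_linear_form_le) auto

text \<open>The gradient has modulus \<open>|\<phi>|^(p - 1)\<close>, which is bounded on the torus
  because \<open>p \<ge> 1\<close>. It can therefore be paired with any integrable function,
  whatever the singularity of its weight.\<close>

lemma integrable_mult_cnj_power_grad: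
  assumes "1 \<le> p" and "integrable torus f"
  shows "integrable torus (\<lambda>z. f z * cnj (power_grad p (linear_form c z)))"
  using assms norm_power_grad_form_le[of p _ c]
  by (intro integrable_torus_mult_bounded[where B = "form_bound c powr (p - 1)"] borel_measurable_cnj)
    auto

lemma integrable_norm_powr_linear_form:
  assumes "0 \<le> p"
  shows "integrable torus (\<lambda>z. norm (linear_form c z) powr p)"
proof (rule integrable_torus_bounded[where B = "form_bound c powr p"])
  show "norm (norm (linear_form c z) powr p) \<le> form_bound c powr p" if "z \<in> space torus" for z
    using powr_mono2[OF assms _ norm_linear_form_le[OF that, of c]] by simp
qed measurable

text \<open>The pointwise inequality is integrated for general \<open>f\<close>: linear forms give
  the differentiability of the moment, Hardy functions the final minimality.\<close>

lemma integral_norm_powr_above_tangent: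
  fixes c :: "complex ^ 'd::finite"
  assumes p: "1 \<le> p" and f: "integrable torus f"
    and fp: "integrable torus (\<lambda>z. norm (linear_form c z + f z) powr p)"
  shows "moment p c + p * Re (inner_torus f (\<lambda>z. power_grad p (linear_form c z)))
    \<le> (LINT z|torus. norm (linear_form c z + f z) powr p)"
proof -
  define g where "g z = f z * cnj (power_grad p (linear_form c z))" for z
  have int: "integrable torus g"
    unfolding g_def by (rule integrable_mult_cnj_power_grad[OF p f])
  have intc: "integrable torus (\<lambda>z. norm (linear_form c z) powr p)"
    using p by (intro integrable_norm_powr_linear_form) auto
  have "moment p c + p * Re (inner_torus f (\<lambda>z. power_grad p (linear_form c z)))
      = (LINT z|torus. norm (linear_form c z) powr p + p * Re (g z))"
    using int intc by (simp add: moment_def inner_torus_def flip: g_def)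
  also have "\<dots> \<le> (LINT z|torus. norm (linear_form c z + f z) powr p)"
  proof (rule integral_mono)
    show "integrable torus (\<lambda>z. norm (linear_form c z) powr p + p * Re (g z))"
      using int intc by simp
    show "norm (linear_form c z) powr p + p * Re (g z) \<le> norm (linear_form c z + f z) powr p" for z
      unfolding g_def by (rule norm_powr_above_tangent[OF p])
  qed (rule fp)
  finally show ?thesis .
qed

lemma moment_above_tangent:
  assumes p: "1 \<le> p"
  shows "moment p c + p * Re (grad_pairing p c h) \<le> moment p (c + h)"
proof -
  have "integrable torus (\<lambda>z. norm (linear_form (c + h) z) powr p)"
    using p by (intro integrable_norm_powr_linear_form) auto
  then show ?thesis
    using integral_norm_powr_above_tangent[OF p integrable_linear_form, of c h]
    by (simp add: moment_def[of p "c + h"] grad_pairing_def linear_form_add)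
qed

lemma moment_pos:
  fixes c :: "complex ^ 'd::finite"
  assumes p: "0 \<le> p" and c: "c \<noteq> 0"
  shows "0 < moment p c"
proof -
  interpret prob_space "torus :: ('d \<Rightarrow> complex) measure" by (rule prob_space_torus)
  have "moment p c \<noteq> 0"
  proof
    assume "moment p c = 0"
    then have "AE z in torus. norm (linear_form c z) powr p = 0"
      unfolding moment_def
      using integral_nonneg_eq_0_iff_AE[OF integrable_norm_powr_linear_form[OF p, of c]] by simp
    then have "AE z in torus :: ('d \<Rightarrow> complex) measure. False"
      using linear_form_neq_zero_AE[OF c] by eventually_elim simp
    then show False by simp
  qed
  moreover have "0 \<le> moment p c"
    unfolding moment_def by (rule Bochner_Integration.integral_nonneg) simp
  ultimately show ?thesis by simp
qed

lemma grad_pairing_add: 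
  assumes "1 \<le> p"
  shows "grad_pairing p c (v + w) = grad_pairing p c v + grad_pairing p c w"
  unfolding grad_pairing_def inner_torus_def linear_form_add distrib_right
  by (intro Bochner_Integration.integral_add integrable_mult_cnj_power_grad[OF assms]
      integrable_linear_form)

lemma grad_pairing_mult: "grad_pairing p c (\<chi> i. a * w $ i) = a * grad_pairing p c w"
  unfolding grad_pairing_def inner_torus_def by (simp add: linear_form_mult mult.assoc)

lemma grad_pairing_scaleR: "grad_pairing p c (r *\<^sub>R w) = r *\<^sub>R grad_pairing p c w"
  unfolding grad_pairing_def inner_torus_def by (simp add: linear_form_scaleR)

lemma grad_pairing_self: "grad_pairing p c c = of_real (moment p c)"
  unfolding grad_pairing_def inner_torus_def moment_def mult_cnj_power_grad
  by (rule integral_complex_of_real)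

lemma bounded_linear_grad_pairing:
  assumes "1 \<le> p"
  shows "bounded_linear (grad_pairing p c)"
  unfolding linear_conv_bounded_linear[symmetric]
  by (rule linearI) (simp_all add: grad_pairing_add[OF assms] grad_pairing_scaleR)

text \<open>Dominated convergence along sequences. The form of \<open>c\<close> is nonzero almost
  everywhere and the gradient is continuous at nonzero points, which gives pointwise convergence; a
  convergent sequence of coefficients is bounded, which gives a constant majorant.\<close>

lemma power_grad_form_L1_continuous:
  fixes c :: "complex ^ 'd::finite"
  assumes p: "1 \<le> p" and c: "c \<noteq> 0"
  shows "((\<lambda>y. LINT z|torus. norm (power_grad p (linear_form y z) - power_grad p (linear_form c z)))
      \<longlongrightarrow> 0) (at c)"
  unfolding tendsto_at_iff_sequentially comp_def
proof (intro allI impI)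
  fix X :: "nat \<Rightarrow> complex ^ 'd"
  assume X: "X \<longlonglongrightarrow> c"
  then obtain B where B: "\<And>n. norm (X n) \<le> B"
    by (metis Bseq_def convergentI convergent_imp_Bseq)
  let ?B = "real CARD('d) * (B + norm c)"
  have "0 \<le> B" using B[of 0] norm_ge_zero[of "X 0"] by linarith
  have le: "form_bound y \<le> ?B" if "norm y \<le> B + norm c" for y :: "complex ^ 'd"
    using that by (intro order_trans[OF form_bound_le] mult_left_mono) auto
  have fb: "form_bound (X n) \<le> ?B" "form_bound c \<le> ?B" for n
    using B[of n] \<open>0 \<le> B\<close> by (auto intro!: le simp: add_increasing2)
  have bnd: "norm (power_grad p (linear_form y z)) \<le> ?B powr (p - 1)"
    if "z \<in> space torus" "form_bound y \<le> ?B" for y z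
    using norm_power_grad_form_le[OF p that(1), of y] powr_mono2[OF _ form_bound_nonneg that(2), of "p - 1"] p
    by linarith
  have "(\<lambda>n. LINT z|torus. norm (power_grad p (linear_form (X n) z) - power_grad p (linear_form c z)))
      \<longlonglongrightarrow> (LINT z|(torus :: ('d \<Rightarrow> complex) measure). 0)"
  proof (rule integral_dominated_convergence[where w = "\<lambda>_. 2 * ?B powr (p - 1)"])
    show "integrable torus (\<lambda>_ :: 'd \<Rightarrow> complex. 2 * ?B powr (p - 1))"
      by (rule integrable_torus_bounded) auto
    show "AE z in torus. (\<lambda>n. norm (power_grad p (linear_form (X n) z) - power_grad p (linear_form c z)))
        \<longlonglongrightarrow> 0"
      using linear_form_neq_zero_AE[OF c]
    proof eventually_elim
      case (elim z)
      have "(\<lambda>n. linear_form (X n) z) \<longlonglongrightarrow> linear_form c z"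
        unfolding linear_form_def by (intro tendsto_intros X)
      then have "(\<lambda>n. power_grad p (linear_form (X n) z)) \<longlonglongrightarrow> power_grad p (linear_form c z)"
        by (rule isCont_tendsto_compose[OF isCont_power_grad[OF elim]])
      then show ?case
        by (intro tendsto_norm_zero LIM_zero)
    qed
    show "AE z in torus. norm (norm (power_grad p (linear_form (X n) z) - power_grad p (linear_form c z)))
        \<le> 2 * ?B powr (p - 1)" for n
    proof (rule AE_I2)
      fix z :: "'d \<Rightarrow> complex" assume z: "z \<in> space torus"
      show "norm (norm (power_grad p (linear_form (X n) z) - power_grad p (linear_form c z)))
          \<le> 2 * ?B powr (p - 1)"
        using norm_triangle_ineq4[of "power_grad p (linear_form (X n) z)" "power_grad p (linear_form c z)"]
          bnd[OF z fb(1)[of n]] bnd[OF z fb(2)] by simp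
    qed
  qed measurable
  then show "(\<lambda>n. LINT z|torus. norm (power_grad p (linear_form (X n) z) - power_grad p (linear_form c z)))
      \<longlonglongrightarrow> 0"
    by simp
qed

lemma norm_grad_pairing_diff_le:
  fixes c y h :: "complex ^ 'd::finite"
  assumes p: "1 \<le> p"
  shows "norm (grad_pairing p y h - grad_pairing p c h)
    \<le> form_bound h * (LINT z|torus. norm (power_grad p (linear_form y z) - power_grad p (linear_form c z)))"
proof -
  let ?D = "\<lambda>z. power_grad p (linear_form y z) - power_grad p (linear_form c z)"
  have intG: "integrable torus (\<lambda>z. power_grad p (linear_form x z))" for x :: "complex ^ 'd"
    by (rule integrable_torus_bounded[OF _ norm_power_grad_form_le[OF p]]) measurable
  have int: "integrable torus (\<lambda>z. linear_form h z * cnj (power_grad p (linear_form x z)))"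
    for x :: "complex ^ 'd"
    by (rule integrable_mult_cnj_power_grad[OF p integrable_linear_form])
  have "grad_pairing p y h - grad_pairing p c h = (LINT z|torus. linear_form h z * cnj (?D z))"
    unfolding grad_pairing_def inner_torus_def
    by (simp add: right_diff_distrib int)
  also have "norm \<dots> \<le> (LINT z|torus. norm (linear_form h z * cnj (?D z)))"
    by (rule integral_norm_bound)
  also have "\<dots> \<le> (LINT z|torus. form_bound h * norm (?D z))"
  proof (rule integral_mono)
    show "integrable torus (\<lambda>z. norm (linear_form h z * cnj (?D z)))"
      unfolding complex_cnj_diff right_diff_distrib
      by (intro integrable_norm Bochner_Integration.integrable_diff int)
    show "integrable torus (\<lambda>z. form_bound h * norm (?D z))"
      using intG by auto
    show "norm (linear_form h z * cnj (?D z)) \<le> form_bound h * norm (?D z)" if "z \<in> space torus" for z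
      unfolding norm_mult complex_mod_cnj
      by (intro mult_right_mono norm_linear_form_le that) simp
  qed
  finally show ?thesis by simp
qed

text \<open>Convexity traps the remainder between \<open>0\<close> and the increment of the gradient.\<close>

lemma has_derivative_moment:
  fixes c :: "complex ^ 'd::finite"
  assumes p: "1 \<le> p" and c: "c \<noteq> 0"
  shows "(moment p has_derivative (\<lambda>h. p * Re (grad_pairing p c h))) (at c)"
proof (rule has_derivativeI_sandwich[where e = 1])
  let ?I = "\<lambda>y. LINT z|torus. norm (power_grad p (linear_form y z) - power_grad p (linear_form c z))"
  show "bounded_linear (\<lambda>h. p * Re (grad_pairing p c h))"
    by (intro bounded_linear_const_mult bounded_linear_compose[OF bounded_linear_Re]
        bounded_linear_grad_pairing p)
  show "((\<lambda>y. p * (real CARD('d) * ?I y)) \<longlongrightarrow> 0) (at c)"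
    using tendsto_mult_right_zero[OF tendsto_mult_right_zero[OF power_grad_form_L1_continuous[OF p c]]]
    by blast
  fix y assume "y \<in> UNIV" "y \<noteq> c" "dist y c < 1"
  define h where "h = y - c"
  have y: "y = c + h" and h: "0 < norm h"
    using \<open>y \<noteq> c\<close> by (auto simp: h_def)
  have "moment p c + p * Re (grad_pairing p c h) \<le> moment p y"
    unfolding y by (rule moment_above_tangent[OF p])
  \<comment> \<open>The tangent inequality based at \<open>y\<close> in direction \<open>- h\<close>
    bounds the increment from above.\<close>
  moreover have "moment p y - p * Re (grad_pairing p y h) \<le> moment p c"
  proof -
    have "grad_pairing p y (- h) = - grad_pairing p y h"
      using grad_pairing_scaleR[of p y "-1" h] by simp
    then show ?thesis
      using moment_above_tangent[OF p, of y "- h"] by (simp add: y)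
  qed
  moreover have "Re (grad_pairing p y h) - Re (grad_pairing p c h) \<le> real CARD('d) * norm h * ?I y"
  proof -
    have "Re (grad_pairing p y h) - Re (grad_pairing p c h) \<le> norm (grad_pairing p y h - grad_pairing p c h)"
      using complex_Re_le_cmod[of "grad_pairing p y h - grad_pairing p c h"] by simp
    also have "\<dots> \<le> form_bound h * ?I y"
      by (rule norm_grad_pairing_diff_le[OF p])
    also have "\<dots> \<le> real CARD('d) * norm h * ?I y"
      by (intro mult_right_mono form_bound_le Bochner_Integration.integral_nonneg) simp
    finally show ?thesis .
  qed
  then have "p * Re (grad_pairing p y h) - p * Re (grad_pairing p c h) \<le> p * (real CARD('d) * norm h * ?I y)"
    using p by (simp flip: right_diff_distrib)
  ultimately have "norm (moment p y - moment p c - p * Re (grad_pairing p c h))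
      \<le> p * (real CARD('d) * ?I y) * norm h"
    by (simp add: mult_ac)
  then show "norm (moment p y - moment p c - p * Re (grad_pairing p c (y - c))) / norm (y - c)
      \<le> p * (real CARD('d) * ?I y)"
    using h by (simp add: pos_divide_le_eq flip: h_def)
qed simp

subsection \<open>Critical points on the sphere\<close>

text \<open>Chain rule for the root at the positive value \<open>moment p c\<close>. Later arguments
  use only the sign of the factor, so its value stays hidden.\<close>

lemma has_derivative_K_functional:
  fixes c :: "complex ^ 'd::finite"
  assumes p: "1 \<le> p" and c: "c \<noteq> 0"
  obtains k where "0 < k" "(K_functional p has_derivative (\<lambda>h. k * Re (grad_pairing p c h))) (at c)"
proof
  have pos: "0 < moment p c"
    using p c by (intro moment_pos) auto
  then show "0 < moment p c powr (1 / p - 1)" by simp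
  have "((\<lambda>x. x powr (1 / p)) has_derivative (*) ((1 / p) * moment p c powr (1 / p - 1)))
      (at (moment p c))"
    using has_real_derivative_powr[OF pos, of "1 / p"] by (simp add: has_field_derivative_def)
  from has_derivative_compose[OF has_derivative_moment[OF p c] this]
  show "(K_functional p has_derivative
      (\<lambda>h. moment p c powr (1 / p - 1) * Re (grad_pairing p c h))) (at c)"
    using p by (simp add: K_functional_def[abs_def] Hp_norm_def moment_def[symmetric] mult_ac)
qed

text \<open>A derivative within the sphere is not determined in the normal direction. Along a great
  circle through \<open>c\<close> with velocity a multiple of \<open>v\<close>, the chain rule
  reduces the claim to uniqueness of the derivative in one real variable. Hence any derivative along
  the sphere can be compared with the ambient one.\<close>

lemma has_derivative_sphere_tangent_unique:
  fixes F :: "'a::euclidean_space \<Rightarrow> real"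
  assumes c: "norm c = 1" and v: "v \<bullet> c = 0"
    and D: "(F has_derivative D) (at c within sphere 0 1)"
    and E: "(F has_derivative E) (at c within sphere 0 1)"
  shows "D v = E v"
proof (cases "v = 0")
  case True
  then show ?thesis
    using has_derivative_bounded_linear[OF D] has_derivative_bounded_linear[OF E]
    by (simp add: bounded_linear.linear linear_0)
next
  case False
  define u where "u = v /\<^sub>R norm v"
  define \<gamma> where "\<gamma> t = cos t *\<^sub>R c + sin t *\<^sub>R u" for t :: real
  have u: "norm u = 1" "u \<bullet> c = 0" "v = norm v *\<^sub>R u"
    using False v by (simp_all add: u_def)
  have "norm (\<gamma> t) = 1" for t
  proof -
    have "(norm (\<gamma> t))\<^sup>2 = (cos t)\<^sup>2 * (norm c)\<^sup>2 + (sin t)\<^sup>2 * (norm u)\<^sup>2"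
      using u(2) unfolding \<gamma>_def power2_norm_eq_inner
      by (simp add: inner_add_left inner_add_right inner_commute[of c u] power2_eq_square)
    then show ?thesis
      using c u(1) by (simp add: power2_eq_1_iff) (metis norm_ge_zero not_one_le_zero neg_0_le_iff_le order_trans)
  qed
  then have sub: "range \<gamma> \<subseteq> sphere 0 1" by auto
  have \<gamma>0: "\<gamma> 0 = c" by (simp add: \<gamma>_def)
  have \<gamma>': "(\<gamma> has_derivative (\<lambda>t. t *\<^sub>R u)) (at 0)"
    unfolding \<gamma>_def[abs_def] by (auto intro!: derivative_eq_intros)
  have chain: "((\<lambda>t. F (\<gamma> t)) has_derivative (\<lambda>t. G (t *\<^sub>R u))) (at 0)"
    if "(F has_derivative G) (at c within sphere 0 1)" for G
    using has_derivative_in_compose[OF \<gamma>', of F G] has_derivative_subset[OF that sub]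
    by (simp add: \<gamma>0)
  have "D u = E u"
    using fun_cong[OF has_derivative_unique[OF chain[OF D] chain[OF E]], of 1] by simp
  then show ?thesis
    using has_derivative_bounded_linear[OF D] has_derivative_bounded_linear[OF E]
    by (subst (1 2) u(3)) (simp add: bounded_linear.linear linear_scale)
qed

lemma inner_eq_Re_cinner: "v \<bullet> w = Re (cinner v w)"
  by (simp add: inner_vec_def cinner_def inner_complex_def)

lemma cinner_mult: "cinner (\<chi> i. a * v $ i) w = a * cinner v w"
  by (simp add: cinner_def sum_distrib_left mult.assoc)

lemma cinner_diff: "cinner (u - v) w = cinner u w - cinner v w"
  by (simp add: cinner_def left_diff_distrib sum_subtractf)

lemma cinner_self: "cinner c c = of_real ((norm c)\<^sup>2)"
proof -
  have "Im (cinner c c) = 0" by (simp add: cinner_def)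
  moreover have "Re (cinner c c) = (norm c)\<^sup>2"
    by (simp add: power2_norm_eq_inner inner_eq_Re_cinner)
  ultimately show ?thesis by (simp add: complex_eq_iff)
qed

text \<open>The real tangent space at \<open>c\<close> is the complex complement of \<open>c\<close>
  plus the real line through \<open>\<i>\<close> times \<open>c\<close>. In that extra direction the
  pairing is \<open>\<i>\<close> times the moment, which has real part 0; this is the invariance
  under phases.\<close>

lemma Re_grad_pairing_tangent_eq_zero:
  assumes p: "1 \<le> p" and c: "norm c = 1"
    and orth: "\<And>w. cinner w c = 0 \<Longrightarrow> Re (grad_pairing p c w) = 0"
    and v: "v \<bullet> c = 0"
  shows "Re (grad_pairing p c v) = 0"
proof -
  \<comment> \<open>Tangency makes this coefficient purely imaginary, and \<open>v - u\<close> below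
    is the projection of \<open>v\<close> onto the complex complement of \<open>c\<close>.\<close>
  define s where "s = cinner v c"
  define u where "u = (\<chi> i. s * c $ i)"
  have "Re s = 0"
    using v by (simp add: s_def inner_eq_Re_cinner)
  have "cinner (v - u) c = 0"
    by (simp add: cinner_diff cinner_self c u_def cinner_mult s_def)
  then have "Re (grad_pairing p c (v - u)) = 0" by (rule orth)
  moreover have "Re (grad_pairing p c u) = 0"
    using \<open>Re s = 0\<close> by (simp add: u_def grad_pairing_mult grad_pairing_self)
  ultimately show ?thesis
    using grad_pairing_add[OF p, of c "v - u" u] by simp
qed

lemma critical_point_K_functional_iff:
  assumes p: "1 \<le> p" and c: "norm c = 1"
  shows "critical_point_on_sphere (K_functional p) c \<longleftrightarrow>
    (\<forall>w. cinner w c = 0 \<longrightarrow> grad_pairing p c w = 0)"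
proof -
  have "c \<noteq> 0" using c by auto
  from has_derivative_K_functional[OF p this] obtain k where k: "0 < k"
    and deriv: "(K_functional p has_derivative (\<lambda>h. k * Re (grad_pairing p c h))) (at c)" .
  show ?thesis
  proof
    assume "critical_point_on_sphere (K_functional p) c"
    then obtain D where D: "(K_functional p has_derivative D) (at c within sphere 0 1)"
      and D0: "\<And>v. v \<bullet> c = 0 \<Longrightarrow> D v = 0"
      unfolding critical_point_on_sphere_def by blast
    have Re0: "Re (grad_pairing p c v) = 0" if "v \<bullet> c = 0" for v
      using has_derivative_sphere_tangent_unique[OF c that D has_derivative_at_withinI[OF deriv]]
        D0[OF that] k by simp
    show "\<forall>w. cinner w c = 0 \<longrightarrow> grad_pairing p c w = 0"
    proof (intro allI impI)
      fix w assume w: "cinner w c = 0"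
      \<comment> \<open>Since \<open>Re (\<i> * x) = - Im x\<close>, this second tangent direction
        controls the imaginary part of the pairing.\<close>
      let ?iw = "\<chi> i. \<i> * w $ i"
      have "Re (grad_pairing p c w) = 0"
        using w by (intro Re0) (simp add: inner_eq_Re_cinner)
      moreover have "Re (grad_pairing p c ?iw) = 0"
        using w by (intro Re0) (simp add: inner_eq_Re_cinner cinner_mult)
      ultimately show "grad_pairing p c w = 0"
        by (simp add: grad_pairing_mult complex_eq_iff)
    qed
  next
    assume "\<forall>w. cinner w c = 0 \<longrightarrow> grad_pairing p c w = 0"
    then have "k * Re (grad_pairing p c v) = 0" if "v \<bullet> c = 0" for v
      using Re_grad_pairing_tangent_eq_zero[OF p c _ that] by simp
    moreover have "c \<in> sphere 0 1"
      using c by simp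
    ultimately show "critical_point_on_sphere (K_functional p) c"
      unfolding critical_point_on_sphere_def using has_derivative_at_withinI[OF deriv] by blast
  qed
qed

text \<open>The competitors \<open>c + t *\<^sub>R v\<close> leave the sphere, so the first-order
  condition comes from the ambient derivative along a real line. Using \<open>w\<close> and
  \<open>\<i>\<close> times \<open>w\<close> removes both the real and the imaginary part.\<close>

lemma grad_pairing_eq_zero_of_minimal:
  assumes p: "1 \<le> p" and c: "c \<noteq> 0"
    and min: "\<And>w. cinner w c = 0 \<Longrightarrow> K_functional p c \<le> K_functional p (c + w)"
    and w: "cinner w c = 0"
  shows "grad_pairing p c w = 0"
proof -
  from has_derivative_K_functional[OF p c] obtain k where k: "0 < k"
    and deriv: "(K_functional p has_derivative (\<lambda>h. k * Re (grad_pairing p c h))) (at c)" .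
  have Re0: "Re (grad_pairing p c v) = 0" if v: "cinner v c = 0" for v
  proof -
    let ?f = "\<lambda>t. K_functional p (c + t *\<^sub>R v)"
    have "((\<lambda>t. c + t *\<^sub>R v) has_derivative (\<lambda>t. t *\<^sub>R v)) (at (0::real))"
      by (auto intro!: derivative_eq_intros)
    from has_derivative_compose[OF this, of "K_functional p"] deriv
    have f': "(?f has_derivative (\<lambda>t. k * Re (grad_pairing p c (t *\<^sub>R v)))) (at 0)"
      by simp
    have "cinner (t *\<^sub>R v) c = 0" for t :: real
      using cinner_mult[of "of_real t" v c] v by (simp add: scaleR_vec_def scaleR_conv_of_real)
    then have "\<forall>\<^sub>F t in at 0. ?f 0 \<le> ?f t"
      using min by (intro always_eventually) simp
    from fun_cong[OF has_derivative_local_min[OF f' this], of 1] show ?thesis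
      using k by simp
  qed
  have "Re (grad_pairing p c (\<chi> i. \<i> * w $ i)) = 0"
    using w by (intro Re0) (simp add: cinner_mult)
  with Re0[OF w] show ?thesis
    by (simp add: grad_pairing_mult complex_eq_iff)
qed

subsection \<open>Functions without frequencies of total degree one\<close>

text \<open>Frequencies with negative entries are included: multiplication by
  \<open>|\<phi>|^2\<close> shifts them but preserves total degree, so the class is stable under
  it.\<close>

definition degree_one_free :: "(('d::finite \<Rightarrow> complex) \<Rightarrow> complex) \<Rightarrow> bool" where
  "degree_one_free F \<longleftrightarrow>
     integrable torus F \<and> (\<forall>\<alpha>. (\<Sum>i\<in>UNIV. \<alpha> i) = 1 \<longrightarrow> fourier_coeff F \<alpha> = 0)"

lemma integrable_mult_component_cnj:
  assumes "integrable torus F"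
  shows "integrable torus (\<lambda>z. F z * (z i * cnj (z j)))"
  by (rule integrable_torus_mult_bounded[OF assms, where B = 1])
    (auto simp: norm_mult norm_torus intro!: borel_measurable_times borel_measurable_cnj)

text \<open>The factor \<open>z i * cnj (z j)\<close> is a character of total degree 0, so it
  translates frequencies without changing their degree.\<close>

lemma fourier_coeff_mult_component_cnj:
  "fourier_coeff (\<lambda>z. F z * (z i * cnj (z j))) \<alpha>
    = fourier_coeff F (\<lambda>k. \<alpha> k + (unit_index j k + - unit_index i k))"
  unfolding fourier_coeff_char
proof (rule Bochner_Integration.integral_cong[OF refl])
  fix z :: "'a \<Rightarrow> complex" assume z: "z \<in> space torus"
  have "torus_char (\<lambda>k. \<alpha> k + (unit_index j k + - unit_index i k)) z
      = torus_char \<alpha> z * (torus_char (unit_index j) z * cnj (torus_char (unit_index i) z))"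
    by (simp only: torus_char_add[OF z] cnj_torus_char[OF z])
  also have "\<dots> = torus_char \<alpha> z * (z j * cnj (z i))"
    by (simp only: torus_char_unit_index)
  finally show "F z * (z i * cnj (z j)) * cnj (torus_char \<alpha> z)
      = F z * cnj (torus_char (\<lambda>k. \<alpha> k + (unit_index j k + - unit_index i k)) z)"
    by (simp only: complex_cnj_mult complex_cnj_cnj mult_ac)
qed

text \<open>Expanding \<open>|\<phi>|^2\<close> as a double sum leaves only the degree 0 factors
  \<open>z i * cnj (z j)\<close>.\<close>

lemma degree_one_free_mult_norm_square:
  fixes c :: "complex ^ 'd::finite"
  assumes F: "degree_one_free F"
  shows "degree_one_free (\<lambda>z. F z * of_real ((norm (linear_form c z))\<^sup>2))"
proof -
  have int: "integrable torus F"
    and coeff: "\<And>\<alpha>. (\<Sum>i\<in>UNIV. \<alpha> i) = 1 \<Longrightarrow> fourier_coeff F \<alpha> = 0"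
    using F by (auto simp: degree_one_free_def)
  have eq: "F z * of_real ((norm (linear_form c z))\<^sup>2)
      = (\<Sum>(i, j)\<in>UNIV. c $ i * cnj (c $ j) * (F z * (z i * cnj (z j))))" for z
  proof -
    have "complex_of_real ((norm (linear_form c z))\<^sup>2) = linear_form c z * cnj (linear_form c z)"
      by (simp only: complex_norm_square)
    also have "\<dots> = (\<Sum>i\<in>UNIV. \<Sum>j\<in>UNIV. (c $ i * z i) * (cnj (c $ j) * cnj (z j)))"
      unfolding linear_form_def cnj_sum complex_cnj_mult by (rule sum_product)
    also have "\<dots> = (\<Sum>(i, j)\<in>UNIV. (c $ i * z i) * (cnj (c $ j) * cnj (z j)))"
      by (simp add: sum.cartesian_product)
    finally show ?thesis
      by (simp add: sum_distrib_left case_prod_unfold mult_ac)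
  qed
  have "fourier_coeff (\<lambda>z. F z * of_real ((norm (linear_form c z))\<^sup>2)) \<alpha> = 0"
    if \<alpha>: "(\<Sum>i\<in>UNIV. \<alpha> i) = 1" for \<alpha>
  proof -
    have shift: "fourier_coeff (\<lambda>z. F z * (z i * cnj (z j))) \<alpha> = 0" for i j
      unfolding fourier_coeff_mult_component_cnj
      by (rule coeff) (simp add: sum.distrib sum_subtractf sum_unit_index \<alpha>)
    show ?thesis
      unfolding eq case_prod_unfold
      by (subst fourier_coeff_sum) (use int in \<open>auto intro: integrable_mult_component_cnj simp: shift\<close>)
  qed
  moreover have "integrable torus (\<lambda>z. F z * of_real ((norm (linear_form c z))\<^sup>2))"
    unfolding eq case_prod_unfold
    by (intro Bochner_Integration.integrable_sum integrable_mult_right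
        integrable_mult_component_cnj int)
  ultimately show ?thesis
    by (simp add: degree_one_free_def)
qed

lemma degree_one_free_mult_norm_power:
  assumes "degree_one_free F"
  shows "degree_one_free (\<lambda>z. F z * of_real (((norm (linear_form c z))\<^sup>2) ^ k))"
proof (induction k)
  case 0
  then show ?case using assms by simp
next
  case (Suc k)
  from degree_one_free_mult_norm_square[OF this, of c] show ?case
    by (simp add: mult_ac)
qed

text \<open>After the powers of \<open>|\<phi>|^2\<close> are absorbed, the pairing with
  \<open>\<phi>\<close> involves only coefficients at unit multi-indices, and these have degree
  one.\<close>

lemma degree_one_free_inner_norm_power:
  assumes "degree_one_free F"
  shows "(LINT z|torus. F z * of_real (((norm (linear_form c z))\<^sup>2) ^ k) * cnj (linear_form c z)) = 0"
proof -
  let ?G = "\<lambda>z. F z * of_real (((norm (linear_form c z))\<^sup>2) ^ k)"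
  have "degree_one_free ?G"
    by (rule degree_one_free_mult_norm_power[OF assms])
  then have int: "integrable torus ?G" and coeff: "fourier_coeff ?G (unit_index i) = 0" for i
    by (auto simp: degree_one_free_def sum_unit_index)
  from inner_torus_linear_form[OF int, of c] show ?thesis
    unfolding coeff by (simp add: inner_torus_def)
qed

section \<open>From polynomial weights to the power weight\<close>

lemma norm_linear_form_square_in:
  "z \<in> space torus \<Longrightarrow> (norm (linear_form c z))\<^sup>2 \<in> {0..(form_bound c)\<^sup>2}"
  using norm_linear_form_le[of z c] by (auto intro: power_mono)

lemma integrable_mult_radial:
  fixes c :: "complex ^ 'd::finite"
  assumes F: "integrable torus F" and h [measurable]: "h \<in> borel_measurable borel"
    and b: "\<And>x. x \<in> {0..(form_bound c)\<^sup>2} \<Longrightarrow> \<bar>h x\<bar> \<le> b"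
  shows "integrable torus (\<lambda>z. F z * of_real (h ((norm (linear_form c z))\<^sup>2)) * cnj (linear_form c z))"
  unfolding mult.assoc
proof (rule integrable_torus_mult_bounded[OF F, where B = "b * form_bound c"])
  show "(\<lambda>z. of_real (h ((norm (linear_form c z))\<^sup>2)) * cnj (linear_form c z)) \<in> borel_measurable torus"
    by (intro borel_measurable_times borel_measurable_cnj) measurable
  show "norm (of_real (h ((norm (linear_form c z))\<^sup>2)) * cnj (linear_form c z)) \<le> b * form_bound c"
    if "z \<in> space torus" for z
    using b[OF norm_linear_form_square_in[OF that]] norm_linear_form_le[OF that, of c]
    by (auto simp: norm_mult intro!: mult_mono intro: order_trans[OF abs_ge_zero])
qed

text \<open>Weierstrass approximation of \<open>h\<close> on an interval containing the range of
  \<open>|\<phi>|^2\<close>. The polynomial weights contribute 0 by linearity, and the error is at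
  most the approximation error times \<open>form_bound c\<close> times the L1 norm of
  \<open>F\<close>.\<close>

lemma degree_one_free_inner_radial:
  fixes c :: "complex ^ 'd::finite" and h :: "real \<Rightarrow> real"
  assumes F: "degree_one_free F" and h [measurable]: "h \<in> borel_measurable borel"
    and cont: "continuous_on {0..(form_bound c)\<^sup>2} h"
  shows "(LINT z|torus. F z * of_real (h ((norm (linear_form c z))\<^sup>2)) * cnj (linear_form c z)) = 0"
    (is "?L h = 0")
proof -
  let ?S = "{0..(form_bound c)\<^sup>2}"
  have intF: "integrable torus F" using F by (simp add: degree_one_free_def)
  have int: "integrable torus (\<lambda>z. F z * of_real (g ((norm (linear_form c z))\<^sup>2)) * cnj (linear_form c z))"
    if g: "g \<in> borel_measurable borel" "continuous_on ?S g" for g :: "real \<Rightarrow> real"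
  proof -
    have "bounded (g ` ?S)"
      by (intro compact_imp_bounded compact_continuous_image g) simp
    then obtain b where "\<forall>x\<in>?S. \<bar>g x\<bar> \<le> b"
      unfolding bounded_iff by auto
    then show ?thesis by (intro integrable_mult_radial[OF intF g(1)]) blast
  qed
  define C where "C = form_bound c * (LINT z|torus. norm (F z))"
  have C: "0 \<le> C"
    unfolding C_def by (intro mult_nonneg_nonneg form_bound_nonneg Bochner_Integration.integral_nonneg) simp
  have approx: "norm (?L h) \<le> e * C" if e: "0 < e" for e
  proof -
    obtain g where g: "real_polynomial_function g" and close: "\<And>x. x \<in> ?S \<Longrightarrow> \<bar>h x - g x\<bar> < e"
      using Stone_Weierstrass_real_polynomial_function[OF compact_Icc cont e] by blast
    obtain a n where g_eq: "g = (\<lambda>x. \<Sum>i\<le>n. a i * x ^ i)"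
      using g unfolding real_polynomial_function_iff_sum by blast
    have g_meas: "g \<in> borel_measurable borel" and g_cont: "continuous_on ?S g"
      unfolding g_eq by (auto intro!: continuous_intros)
    have "?L g = (LINT z|torus. (\<Sum>i\<le>n. of_real (a i) *
        (F z * of_real (((norm (linear_form c z))\<^sup>2) ^ i) * cnj (linear_form c z))))"
      unfolding g_eq by (simp add: sum_distrib_left sum_distrib_right mult_ac)
    also have "\<dots> = (\<Sum>i\<le>n. of_real (a i) *
        (LINT z|torus. F z * of_real (((norm (linear_form c z))\<^sup>2) ^ i) * cnj (linear_form c z)))"
      by (subst Bochner_Integration.integral_sum)
        (auto simp del: of_real_power intro!: integrable_mult_right int continuous_intros)
    also have "\<dots> = 0"
      unfolding degree_one_free_inner_norm_power[OF F] by simp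
    finally have "?L g = 0" .
    let ?d = "\<lambda>z. F z * of_real (h ((norm (linear_form c z))\<^sup>2)) * cnj (linear_form c z)
        - F z * of_real (g ((norm (linear_form c z))\<^sup>2)) * cnj (linear_form c z)"
    have "(LINT z|torus. ?d z) = ?L h - ?L g"
      by (rule Bochner_Integration.integral_diff) (intro int h cont g_meas g_cont)+
    with \<open>?L g = 0\<close> have "?L h = (LINT z|torus. ?d z)" by simp
    then have "norm (?L h) \<le> (LINT z|torus. norm (?d z))"
      by (simp only: integral_norm_bound)
    also have "\<dots> \<le> (LINT z|torus. (e * form_bound c) * norm (F z))"
    proof (rule integral_mono)
      show "integrable torus (\<lambda>z. norm (?d z))"
        by (intro integrable_norm Bochner_Integration.integrable_diff int h cont g_meas g_cont)
      show "integrable torus (\<lambda>z. e * form_bound c * norm (F z))"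
        using intF by simp
      fix z :: "'d \<Rightarrow> complex" assume z: "z \<in> space torus"
      let ?x = "(norm (linear_form c z))\<^sup>2"
      have "?d z = F z * (of_real (h ?x - g ?x) * cnj (linear_form c z))"
        by (simp add: algebra_simps)
      then have "norm (?d z) = norm (F z) * (\<bar>h ?x - g ?x\<bar> * norm (linear_form c z))"
        by (simp only: norm_mult norm_of_real complex_mod_cnj)
      also have "\<dots> \<le> norm (F z) * (e * form_bound c)"
        using close[OF norm_linear_form_square_in[OF z]] norm_linear_form_le[OF z, of c] e
        by (intro mult_left_mono mult_mono) auto
      finally show "norm (?d z) \<le> e * form_bound c * norm (F z)"
        by (simp add: mult_ac)
    qed
    finally show ?thesis by (simp add: C_def mult_ac)
  qed
  have "norm (?L h) \<le> 0 + d" if d: "0 < d" for d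
  proof -
    \<comment> \<open>Adding one to \<open>C\<close> covers the case \<open>C = 0\<close>.\<close>
    have "d / (C + 1) * C \<le> d"
      using d C by (simp add: field_simps)
    with approx[of "d / (C + 1)"] d C show ?thesis by simp
  qed
  then have "norm (?L h) \<le> 0" by (rule field_le_epsilon)
  then show ?thesis by simp
qed

text \<open>For \<open>p < 2\<close> the weight \<open>x powr ((p - 2) / 2)\<close> is singular at \<open>0\<close> and is regularized
  by shifting \<open>x\<close>.\<close>

lemma degree_one_free_inner_power_grad:
  fixes c :: "complex ^ 'd::finite"
  assumes p: "1 \<le> p" and F: "degree_one_free F"
  shows "inner_torus F (\<lambda>z. power_grad p (linear_form c z)) = 0"
proof -
  have intF: "integrable torus F" using F by (simp add: degree_one_free_def)
  then have [measurable]: "F \<in> borel_measurable torus" by simp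
  define h where "h n x = (x + 1 / real (Suc n)) powr ((p - 2) / 2)" for n x
  have h_meas [measurable]: "h n \<in> borel_measurable borel" for n
    unfolding h_def by measurable
  define s where "s n z = F z * of_real (h n ((norm (linear_form c z))\<^sup>2)) * cnj (linear_form c z)" for n z
  have "continuous_on {0..(form_bound c)\<^sup>2} (h n)" for n
    unfolding h_def by (auto intro!: continuous_intros simp: add_nonneg_eq_0_iff)
  then have s0: "(LINT z|torus. s n z) = 0" for n
    unfolding s_def by (rule degree_one_free_inner_radial[OF F h_meas])
  \<comment> \<open>With \<open>y = |\<phi>|^2 + 1 / real (Suc n)\<close>, the singular weight times
    \<open>|\<phi>| \<le> sqrt y\<close> is at most \<open>y powr ((p - 1) / 2)\<close>. This
    exponent is nonnegative and \<open>y\<close> is at most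
    \<open>(form_bound c)^2 + 1\<close>.\<close>
  let ?B = "((form_bound c)\<^sup>2 + 1) powr ((p - 1) / 2)"
  have "(\<lambda>n. LINT z|torus. s n z) \<longlonglongrightarrow> (LINT z|torus. F z * cnj (power_grad p (linear_form c z)))"
  proof (rule integral_dominated_convergence[where w = "\<lambda>z. ?B * norm (F z)"])
    show "integrable torus (\<lambda>z. ?B * norm (F z))"
      using intF by simp
    show "(\<lambda>z. F z * cnj (power_grad p (linear_form c z))) \<in> borel_measurable torus"
      using integrable_mult_cnj_power_grad[OF p intF] by simp
    show "s n \<in> borel_measurable torus" for n
      unfolding s_def[abs_def] by (intro borel_measurable_times borel_measurable_cnj) measurable
    show "AE z in torus. (\<lambda>n. s n z) \<longlonglongrightarrow> F z * cnj (power_grad p (linear_form c z))"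
    proof (rule AE_I2)
      fix z
      show "(\<lambda>n. s n z) \<longlonglongrightarrow> F z * cnj (power_grad p (linear_form c z))"
      \<comment> \<open>At zeros of the form the factor \<open>cnj (linear_form c z)\<close> makes
        both the sequence and the limit vanish.\<close>
      proof (cases "linear_form c z = 0")
        case False
        let ?x = "(norm (linear_form c z))\<^sup>2"
        have "(\<lambda>n. ?x + 1 / real (Suc n)) \<longlonglongrightarrow> ?x + 0"
          by (intro tendsto_intros LIMSEQ_Suc[OF lim_1_over_n])
        then have "(\<lambda>n. h n ?x) \<longlonglongrightarrow> ?x powr ((p - 2) / 2)"
          unfolding h_def using False by (intro tendsto_intros) auto
        moreover have "?x powr ((p - 2) / 2) = norm (linear_form c z) powr (p - 2)"
        proof -
          have "?x powr ((p - 2) / 2) = (norm (linear_form c z) powr 2) powr ((p - 2) / 2)"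
            using False by simp
          also have "\<dots> = norm (linear_form c z) powr (p - 2)"
            unfolding powr_powr by (rule arg_cong[where f = "(powr) (norm (linear_form c z))"]) argo
          finally show ?thesis .
        qed
        ultimately have "(\<lambda>n. h n ?x) \<longlonglongrightarrow> norm (linear_form c z) powr (p - 2)"
          by simp
        then have "(\<lambda>n. s n z) \<longlonglongrightarrow>
            F z * of_real (norm (linear_form c z) powr (p - 2)) * cnj (linear_form c z)"
          unfolding s_def by (intro tendsto_intros)
        then show ?thesis
          by (simp add: power_grad_def mult.assoc)
      qed (simp add: s_def power_grad_def)
    qed
    show "AE z in torus. norm (s n z) \<le> ?B * norm (F z)" for n
    proof (rule AE_I2)
      fix z :: "'d \<Rightarrow> complex" assume z: "z \<in> space torus"
      let ?x = "(norm (linear_form c z))\<^sup>2"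
      define y where "y = ?x + 1 / real (Suc n)"
      have y: "0 < y" unfolding y_def by (intro add_nonneg_pos) auto
      have "h n ?x * norm (linear_form c z) \<le> y powr ((p - 2) / 2) * y powr (1 / 2)"
      proof -
        have "norm (linear_form c z) \<le> sqrt y"
          unfolding y_def by (rule real_le_rsqrt) simp
        then show ?thesis
          using y unfolding h_def y_def[symmetric] by (simp add: powr_half_sqrt mult_left_mono)
      qed
      also have "\<dots> = y powr ((p - 1) / 2)"
        by (simp add: diff_divide_distrib flip: powr_add)
      also have "\<dots> \<le> ?B"
      proof (rule powr_mono2)
        have "1 / real (Suc n) \<le> 1" by simp
        then show "y \<le> (form_bound c)\<^sup>2 + 1"
          using norm_linear_form_square_in[OF z, of c] unfolding y_def by (intro add_mono) auto
      qed (use p y in auto)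
      finally have "h n ?x * norm (linear_form c z) \<le> ?B" .
      then have "norm (F z) * (h n ?x * norm (linear_form c z)) \<le> norm (F z) * ?B"
        by (rule mult_left_mono) simp
      moreover have "norm (s n z) = norm (F z) * (h n ?x * norm (linear_form c z))"
        unfolding s_def norm_mult norm_of_real complex_mod_cnj by (simp add: h_def)
      ultimately show "norm (s n z) \<le> ?B * norm (F z)"
        by (simp add: mult.commute)
    qed
  qed
  then show ?thesis
    unfolding s0 inner_torus_def by (simp add: LIMSEQ_const_iff)
qed

subsection \<open>Hilbert points\<close>

lemma norm_add_powr_le:
  fixes a b :: "'a::real_normed_vector"
  assumes p: "0 \<le> p"
  shows "norm (a + b) powr p \<le> 2 powr p * (norm a powr p + norm b powr p)"
proof -
  define m where "m = max (norm a) (norm b)"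
  have "norm (a + b) \<le> 2 * m"
    using norm_triangle_ineq[of a b] by (simp add: m_def)
  then have "norm (a + b) powr p \<le> (2 * m) powr p"
    using p by (intro powr_mono2) auto
  also have "\<dots> = 2 powr p * m powr p"
    by (simp add: powr_mult m_def)
  also have "m powr p \<le> norm a powr p + norm b powr p"
    by (simp add: m_def max_def)
  finally show ?thesis by simp
qed

lemma integrable_norm_powr_add:
  fixes f g :: "('d::finite \<Rightarrow> complex) \<Rightarrow> complex"
  assumes p: "0 \<le> p"
    and [measurable]: "f \<in> borel_measurable torus" "g \<in> borel_measurable torus"
    and int: "integrable torus (\<lambda>z. norm (f z) powr p)" "integrable torus (\<lambda>z. norm (g z) powr p)"
  shows "integrable torus (\<lambda>z. norm (f z + g z) powr p)"
proof (rule Bochner_Integration.integrable_bound)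
  show "integrable torus (\<lambda>z. 2 powr p * (norm (f z) powr p + norm (g z) powr p))"
    using int by simp
  show "AE z in torus. norm (norm (f z + g z) powr p)
      \<le> norm (2 powr p * (norm (f z) powr p + norm (g z) powr p))"
    using norm_add_powr_le[OF p, of "f z" "g z" for z] by (intro AE_I2) (simp add: add_nonneg_nonneg)
qed measurable

text \<open>The torus has finite measure, and \<open>t \<le> 1 + t powr p\<close> for
  \<open>t \<ge> 0\<close>.\<close>

lemma integrable_of_norm_powr:
  fixes f :: "('d::finite \<Rightarrow> complex) \<Rightarrow> complex"
  assumes p: "1 \<le> p" and f: "f \<in> borel_measurable torus"
    and fp: "integrable torus (\<lambda>z. norm (f z) powr p)"
  shows "integrable torus f"
proof (rule Bochner_Integration.integrable_bound)
  have "integrable torus (\<lambda>_ :: 'd \<Rightarrow> complex. 1 :: real)"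
    by (rule integrable_torus_bounded[where B = 1]) auto
  then show "integrable torus (\<lambda>z. 1 + norm (f z) powr p)"
    using fp by simp
  have "norm (f z) \<le> 1 + norm (f z) powr p" for z
  proof (cases "norm (f z) \<le> 1")
    case True
    then show ?thesis by (simp add: add_increasing2)
  next
    case False
    then show ?thesis using powr_mono[OF p, of "norm (f z)"] by simp
  qed
  then show "AE z in torus. norm (f z) \<le> norm (1 + norm (f z) powr p)"
    by (intro AE_I2) (simp add: add_nonneg_nonneg)
qed (rule f)

text \<open>A crude replacement for Hoelder's inequality: pointwise
  \<open>|f| \<le> e + e powr (1 - p) * |f| powr p\<close>, by comparing \<open>|f|\<close> with
  \<open>e\<close>. Each summand has integral at most \<open>e\<close>, hence the factor 2.\<close>

lemma integral_norm_le_of_Hp_norm_less: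
  fixes f :: "('d::finite \<Rightarrow> complex) \<Rightarrow> complex"
  assumes p: "1 \<le> p" and f: "f \<in> borel_measurable torus"
    and fp: "integrable torus (\<lambda>z. norm (f z) powr p)"
    and e: "0 < e" "Hp_norm p f < e"
  shows "(LINT z|torus. norm (f z)) \<le> 2 * e"
proof -
  interpret prob_space "torus :: ('d \<Rightarrow> complex) measure" by (rule prob_space_torus)
  let ?I = "LINT z|torus. norm (f z) powr p"
  have I: "0 \<le> ?I" by (rule Bochner_Integration.integral_nonneg) simp
  have "?I = (?I powr (1 / p)) powr p"
    using p I by (simp add: powr_powr)
  also have "\<dots> \<le> e powr p"
    using p e by (intro powr_mono2) (auto simp: Hp_norm_def)
  finally have "?I \<le> e powr p" .
  then have "e powr (1 - p) * ?I \<le> e powr (1 - p) * e powr p"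
    by (rule mult_left_mono) simp
  also have "\<dots> = e"
    using e by (simp flip: powr_add)
  finally have I_le: "e powr (1 - p) * ?I \<le> e" .
  have "norm (f z) \<le> e + e powr (1 - p) * norm (f z) powr p" for z
  proof (cases "norm (f z) \<le> e")
    case True
    then show ?thesis by (simp add: add_increasing2)
  next
    case False
    then have "e powr (p - 1) \<le> norm (f z) powr (p - 1)"
      using p e by (intro powr_mono2) auto
    then have "e powr (1 - p) * e powr (p - 1) \<le> e powr (1 - p) * norm (f z) powr (p - 1)"
      by (rule mult_left_mono) simp
    then have "1 \<le> e powr (1 - p) * norm (f z) powr (p - 1)"
      using e by (simp flip: powr_add)
    then have "norm (f z) * 1 \<le> norm (f z) * (e powr (1 - p) * norm (f z) powr (p - 1))"
      by (rule mult_left_mono) simp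
    also have "\<dots> = e powr (1 - p) * norm (f z) powr p"
      using False e powr_add[of "norm (f z)" "p - 1" 1] by simp
    finally show ?thesis using e by simp
  qed
  then have "(LINT z|torus. norm (f z)) \<le> (LINT z|torus. e + e powr (1 - p) * norm (f z) powr p)"
    using fp integrable_of_norm_powr[OF p f fp] by (intro integral_mono) auto
  also have "\<dots> = e + e powr (1 - p) * ?I"
    using fp by (simp add: prob_space)
  finally show ?thesis using I_le by simp
qed

section \<open>Membership and orthogonality in Hardy spaces\<close>

lemma Hardy_integrable:
  assumes "1 \<le> p" "f \<in> Hardy p"
  shows "integrable torus f"
  using assms by (intro integrable_of_norm_powr) (auto simp: Hardy_def)

lemma linear_form_in_Hardy:
  assumes "1 \<le> p"
  shows "linear_form c \<in> Hardy p"
proof -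
  have "fourier_coeff (linear_form c) \<alpha> = 0" if "\<alpha> i < 0" for \<alpha> i
    unfolding fourier_coeff_linear_form
    using that by (intro sum.neutral ballI) (auto simp: unit_index_def split: if_splits)
  then show ?thesis
    using assms integrable_norm_powr_linear_form[of p c] by (auto simp: Hardy_def)
qed

lemma linear_form_in_analytic_polynomials: "linear_form c \<in> analytic_polynomials"
proof -
  define u :: "'a \<Rightarrow> 'a \<Rightarrow> nat" where "u i j = (if j = i then 1 else 0)" for i j
  have inj: "inj u"
    by (rule injI) (metis u_def zero_neq_one)
  have u: "(\<Prod>j\<in>UNIV. z j ^ u i j) = z i" for z :: "'a \<Rightarrow> complex" and i
  proof -
    have "(\<Prod>j\<in>UNIV. z j ^ u i j) = (\<Prod>j\<in>UNIV. if j = i then z i else 1)"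
      by (intro prod.cong) (auto simp: u_def)
    then show ?thesis by simp
  qed
  \<comment> \<open>Polynomials are summed over sets of exponents, so the coordinate belonging to an
    exponent is recovered with \<open>inv u\<close>.\<close>
  have "linear_form c = (\<lambda>z. \<Sum>\<alpha>\<in>range u. c $ inv u \<alpha> * (\<Prod>i\<in>UNIV. z i ^ \<alpha> i))"
    unfolding sum.reindex[OF inj] by (simp add: fun_eq_iff linear_form_def inj u)
  then show ?thesis
    unfolding analytic_polynomials_def
    by (intro CollectI exI[of _ "range u"] exI[of _ "\<lambda>\<alpha>. c $ inv u \<alpha>"]) simp
qed

lemma analytic_polynomial_bounded:
  assumes "g \<in> analytic_polynomials"
  obtains B where "g \<in> borel_measurable torus" "\<forall>z\<in>space torus. norm (g z) \<le> B"
proof -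
  obtain A a where g: "g = (\<lambda>z. \<Sum>\<alpha>\<in>A. a \<alpha> * (\<Prod>i\<in>UNIV. z i ^ \<alpha> i))"
    using assms unfolding analytic_polynomials_def by blast
  show thesis
  proof
    show "g \<in> borel_measurable torus" unfolding g by measurable
    show "\<forall>z\<in>space torus. norm (g z) \<le> (\<Sum>\<alpha>\<in>A. norm (a \<alpha>))"
      unfolding g
      by (intro ballI order_trans[OF norm_sum])
        (simp add: norm_mult norm_power norm_torus flip: prod_norm)
  qed
qed

text \<open>For \<open>p < 2\<close> the relation is inherited from the approximating polynomials:
  the form is bounded on the torus, so the pairing is continuous in L1, which the p-norm controls.
  For \<open>p \<ge> 2\<close> it is the definition.\<close>

lemma Hp_orthogonal_imp_inner_torus_eq_zero:
  assumes p: "1 \<le> p" and f: "f \<in> Hardy p" and orth: "Hp_orthogonal p f (linear_form c)"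
  shows "inner_torus f (linear_form c) = 0"
proof (cases "p < 2")
  case True
  have intf: "integrable torus f" by (rule Hardy_integrable[OF p f])
  have int_cnj: "integrable torus (\<lambda>z. h z * cnj (linear_form c z))" if "integrable torus h" for h
    by (rule integrable_torus_mult_bounded[OF that borel_measurable_cnj, where B = "form_bound c"])
      (auto intro: norm_linear_form_le)
  have approx: "norm (inner_torus f (linear_form c)) \<le> form_bound c * (2 * e)" if e: "0 < e" for e
  proof -
    obtain g where g: "g \<in> analytic_polynomials" "inner_torus g (linear_form c) = 0"
      and close: "Hp_norm p (\<lambda>z. f z - g z) < e"
      using orth True e unfolding Hp_orthogonal_def Hp_closure_def by auto
    obtain B where g_meas: "g \<in> borel_measurable torus" and "\<forall>z\<in>space torus. norm (g z) \<le> B"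
      using analytic_polynomial_bounded[OF g(1)] .
    then have B: "norm (g z) \<le> B" if "z \<in> space torus" for z
      using that by blast
    have intg: "integrable torus g" by (rule integrable_torus_bounded[OF g_meas B])
    have "integrable torus (\<lambda>z. norm (- g z) powr p)"
    proof (rule integrable_torus_bounded[where B = "B powr p"])
      show "norm (norm (- g z) powr p) \<le> B powr p" if "z \<in> space torus" for z
        using powr_mono2[OF _ _ B[OF that], of p] p by simp
    qed (use g_meas in measurable)
    moreover have "f \<in> borel_measurable torus" "integrable torus (\<lambda>z. norm (f z) powr p)"
      using f by (auto simp: Hardy_def)
    ultimately have fg: "integrable torus (\<lambda>z. norm (f z - g z) powr p)"
      using integrable_norm_powr_add[of p f "\<lambda>z. - g z"] p g_meas by simp
    have "inner_torus f (linear_form c) = (LINT z|torus. (f z - g z) * cnj (linear_form c z))"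
      unfolding left_diff_distrib
      using g(2) int_cnj[OF intf] int_cnj[OF intg] by (simp add: inner_torus_def)
    also have "norm \<dots> \<le> (LINT z|torus. norm ((f z - g z) * cnj (linear_form c z)))"
      by (rule integral_norm_bound)
    also have "\<dots> \<le> (LINT z|torus. form_bound c * norm (f z - g z))"
    proof (rule integral_mono)
      show "integrable torus (\<lambda>z. norm ((f z - g z) * cnj (linear_form c z)))"
        by (intro integrable_norm int_cnj Bochner_Integration.integrable_diff intf intg)
      show "integrable torus (\<lambda>z. form_bound c * norm (f z - g z))"
        by (intro integrable_mult_right integrable_norm Bochner_Integration.integrable_diff intf intg)
      show "norm ((f z - g z) * cnj (linear_form c z)) \<le> form_bound c * norm (f z - g z)"
        if "z \<in> space torus" for z
        unfolding norm_mult complex_mod_cnj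
        by (subst mult.commute) (intro mult_right_mono norm_linear_form_le that norm_ge_zero)
    qed
    also have "\<dots> = form_bound c * (LINT z|torus. norm (f z - g z))"
      by simp
    also have "\<dots> \<le> form_bound c * (2 * e)"
    proof (rule mult_left_mono[OF integral_norm_le_of_Hp_norm_less[OF p _ fg e close] form_bound_nonneg])
      show "(\<lambda>z. f z - g z) \<in> borel_measurable torus"
        using intf g_meas by measurable
    qed
    finally show ?thesis .
  qed
  have "norm (inner_torus f (linear_form c)) \<le> 0 + d" if d: "0 < d" for d
  proof -
    define K where "K = form_bound c"
    have K: "0 \<le> K" by (simp add: K_def form_bound_nonneg)
    have "K * (2 * (d / (2 * (K + 1)))) \<le> d"
      using d K by (simp add: field_simps)
    with approx[of "d / (2 * (K + 1))"] d K show ?thesis by (simp add: K_def)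
  qed
  then have "norm (inner_torus f (linear_form c)) \<le> 0" by (rule field_le_epsilon)
  then show ?thesis by simp
qed (use orth in \<open>simp add: Hp_orthogonal_def\<close>)

text \<open>A linear form is itself an analytic polynomial, so it serves as its own approximant when
  \<open>p < 2\<close>.\<close>

lemma Hp_orthogonal_linear_form:
  assumes p: "1 \<le> p" and w: "cinner w c = 0"
  shows "Hp_orthogonal p (linear_form w) (linear_form c)"
proof -
  have inner: "inner_torus (linear_form w) (linear_form c) = 0"
    using w by (simp add: inner_torus_linear_forms)
  have "Hp_norm p (\<lambda>z :: 'a \<Rightarrow> complex. linear_form w z - linear_form w z) = 0"
    using p by (simp add: Hp_norm_def)
  then have "\<exists>g\<in>{g \<in> analytic_polynomials. inner_torus g (linear_form c) = 0}.
      Hp_norm p (\<lambda>z. linear_form w z - g z) < e" if "0 < e" for e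
    using linear_form_in_analytic_polynomials[of w] inner that
    by (intro bexI[of _ "linear_form w"]) auto
  then show ?thesis
    using inner linear_form_in_Hardy[OF p, of w] by (simp add: Hp_orthogonal_def Hp_closure_def)
qed

section \<open>The degree-one part of a Hardy function\<close>

lemma nonneg_sum_one_eq_unit_index:
  fixes \<alpha> :: "'d::finite \<Rightarrow> int"
  assumes nonneg: "\<And>i. 0 \<le> \<alpha> i" and sum: "(\<Sum>i\<in>UNIV. \<alpha> i) = 1"
  obtains i where "\<alpha> = unit_index i"
proof -
  have "\<exists>i. \<alpha> i \<noteq> 0"
    using sum by (metis sum.neutral zero_neq_one)
  then obtain i where "\<alpha> i \<noteq> 0" by blast
  with nonneg[of i] have i: "1 \<le> \<alpha> i" by linarith
  have rest: "(\<Sum>j\<in>UNIV - {i}. \<alpha> j) = 1 - \<alpha> i"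
    using sum by (simp add: sum.remove[of UNIV i])
  moreover have "0 \<le> (\<Sum>j\<in>UNIV - {i}. \<alpha> j)"
    by (rule sum_nonneg) (rule nonneg)
  ultimately have "\<alpha> i = 1" using i by linarith
  with rest have "(\<Sum>j\<in>UNIV - {i}. \<alpha> j) = 0" by simp
  then have "\<forall>j\<in>UNIV - {i}. \<alpha> j = 0"
    using nonneg by (subst (asm) sum_nonneg_eq_0_iff) auto
  with \<open>\<alpha> i = 1\<close> have "\<alpha> = unit_index i"
    by (auto simp: unit_index_def fun_eq_iff)
  then show thesis by (rule that)
qed

text \<open>A frequency of total degree one either has a negative entry, where both coefficients
  vanish by analyticity, or is a unit multi-index, where the subtracted form cancels the
  coefficient.\<close>

lemma Hardy_degree_one_part:
  assumes p: "1 \<le> p" and f: "f \<in> Hardy p"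
  shows "degree_one_free (\<lambda>z. f z - linear_form (\<chi> i. fourier_coeff f (unit_index i)) z)"
proof -
  let ?w = "\<chi> i. fourier_coeff f (unit_index i)"
  have intf: "integrable torus f" by (rule Hardy_integrable[OF p f])
  have "fourier_coeff (\<lambda>z. f z - linear_form ?w z) \<alpha> = 0" if sum: "(\<Sum>i\<in>UNIV. \<alpha> i) = 1" for \<alpha>
  proof -
    have "fourier_coeff (\<lambda>z. f z - linear_form ?w z) \<alpha>
        = fourier_coeff f \<alpha> - fourier_coeff (linear_form ?w) \<alpha>"
      unfolding fourier_coeff_char left_diff_distrib
      by (intro Bochner_Integration.integral_diff integrable_fourier intf integrable_linear_form)
    also have "\<dots> = 0"
    proof (cases "\<exists>i. \<alpha> i < 0")
      case True
      then show ?thesis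
        using f linear_form_in_Hardy[OF p, of ?w] by (auto simp: Hardy_def)
    next
      case False
      then obtain i where "\<alpha> = unit_index i"
        using nonneg_sum_one_eq_unit_index[OF _ sum] by (metis not_less)
      then show ?thesis by (simp add: fourier_coeff_linear_form_unit)
    qed
    finally show ?thesis .
  qed
  then show ?thesis
    using intf integrable_linear_form[of ?w] by (simp add: degree_one_free_def)
qed

lemma inner_torus_power_grad_Hardy:
  assumes p: "1 \<le> p" and f: "f \<in> Hardy p"
  shows "inner_torus f (\<lambda>z. power_grad p (linear_form c z))
    = grad_pairing p c (\<chi> i. fourier_coeff f (unit_index i))"
proof -
  let ?w = "\<chi> i. fourier_coeff f (unit_index i)"
  have "inner_torus (\<lambda>z. f z - linear_form ?w z) (\<lambda>z. power_grad p (linear_form c z)) = 0"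
    by (rule degree_one_free_inner_power_grad[OF p Hardy_degree_one_part[OF p f]])
  then show ?thesis
    unfolding grad_pairing_def inner_torus_def left_diff_distrib
    using integrable_mult_cnj_power_grad[OF p Hardy_integrable[OF p f], of c]
      integrable_mult_cnj_power_grad[OF p integrable_linear_form[of ?w], of c]
    by simp
qed

theorem lemma1p5:
  fixes p :: real and c :: "complex ^ 'd::finite"
  assumes "1 \<le> p" and "c \<in> sphere 0 1"
  shows "critical_point_on_sphere (K_functional p) c \<longleftrightarrow> Hilbert_point p (linear_form c)"
proof -
  note p = assms(1)
  have norm_c: "norm c = 1" and c: "c \<noteq> 0"
    using assms(2) by auto
  have "Hilbert_point p (linear_form c) \<longleftrightarrow> (\<forall>w. cinner w c = 0 \<longrightarrow> grad_pairing p c w = 0)"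
  proof
    assume H: "Hilbert_point p (linear_form c)"
    \<comment> \<open>Linear forms already provide enough competitors for this direction.\<close>
    have "K_functional p c \<le> K_functional p (c + w)" if "cinner w c = 0" for w
      using H linear_form_in_Hardy[OF p, of w] Hp_orthogonal_linear_form[OF p that]
      by (auto simp: Hilbert_point_def K_functional_def linear_form_add[abs_def])
    then show "\<forall>w. cinner w c = 0 \<longrightarrow> grad_pairing p c w = 0"
      using grad_pairing_eq_zero_of_minimal[OF p c] by blast
  next
    assume vanish: "\<forall>w. cinner w c = 0 \<longrightarrow> grad_pairing p c w = 0"
    have "\<not> (AE z in torus. linear_form c z = 0)"
    proof
      interpret prob_space "torus :: ('d \<Rightarrow> complex) measure" by (rule prob_space_torus)
      assume "AE z in torus. linear_form c z = 0"
      with linear_form_neq_zero_AE[OF c] have "AE z in torus :: ('d \<Rightarrow> complex) measure. False"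
        by eventually_elim simp
      then show False by simp
    qed
    moreover have "Hp_norm p (linear_form c) \<le> Hp_norm p (\<lambda>z. linear_form c z + f z)"
      if f: "f \<in> Hardy p" and orth: "Hp_orthogonal p f (linear_form c)" for f
    proof -
      let ?w = "\<chi> i. fourier_coeff f (unit_index i)"
      \<comment> \<open>Orthogonality of \<open>f\<close> to the form is read off its coefficient
        vector, to which the assumption on \<open>grad_pairing\<close> applies.\<close>
      have "cinner ?w c = inner_torus f (linear_form c)"
        by (simp add: inner_torus_linear_form[OF Hardy_integrable[OF p f]] cinner_def)
      also have "\<dots> = 0"
        by (rule Hp_orthogonal_imp_inner_torus_eq_zero[OF p f orth])
      finally have "inner_torus f (\<lambda>z. power_grad p (linear_form c z)) = 0"
        using vanish by (simp add: inner_torus_power_grad_Hardy[OF p f])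
      moreover have "integrable torus (\<lambda>z. norm (linear_form c z + f z) powr p)"
        using f linear_form_in_Hardy[OF p, of c] p
        by (intro integrable_norm_powr_add) (auto simp: Hardy_def)
      ultimately have "moment p c \<le> (LINT z|torus. norm (linear_form c z + f z) powr p)"
        using integral_norm_powr_above_tangent[OF p Hardy_integrable[OF p f], of c] by simp
      then show ?thesis
        unfolding Hp_norm_def moment_def
        using p by (intro powr_mono2 Bochner_Integration.integral_nonneg) auto
    qed
    ultimately show "Hilbert_point p (linear_form c)"
      using linear_form_in_Hardy[OF p] by (simp add: Hilbert_point_def)
  qed
  with critical_point_K_functional_iff[OF p norm_c] show ?thesis by blast
qed

end
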